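(* Let $m\ge 0$ be an integer and let $(X_t)_{t\in\mathbb{Z}}$ be a real-valued, strictly stationary, $m$-dependent sequence which is regularly varying with index $\alpha=2$, has $\mathbb{E}[X]=0$ and $\mathrm{var}(X)=\infty$, and has spectral tail process $(\Theta_t)_{t\in\mathbb{Z}}$. Let $S_n=X_1+\cdots+X_n$ and let $(a_n)$ be defined by $$n\,\mathbb{P}(|X|>a_n)+\frac{n}{a_n^2}\,\mathbb{E}\big[X^2\,\mathbf 1(|X|\le a_n)\big]=1 .$$ Then, for block lengths $r_n\to\infty$ growing sufficiently slowly (that is, there is a sequence $\rho_n\to\infty$ such that the following holds for every integer sequence $r_n\to\infty$ with $1\le r_n\le\rho_n$), with $k_n=\lfloor n/r_n\rfloor$, for every $\varepsilon>0$, $$k_n\,\mathrm{var}\big((S_{r_n}/a_n)\,\mathbf 1(|S_{r_n}/a_n|\le\varepsilon)\big)\ \to\ \sigma^2,\qquad n\to\infty,$$ where $$\sigma^2=\mathbb{E}\Big[\Big(\sum_{t=0}^m\Theta_t\Big)^2\,\mathbf 1\big(\Theta_{-i}=0,\ i=1,\ldots,m\big)\Big].$$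
   Context: $X$ denotes a generic element of $(X_t)$, i.e. $X$ has the law of $X_0$. A strictly stationary real-valued sequence $(X_t)$ is regularly varying with index $\alpha=2$ if (i) there exist a slowly varying function $L$ and constants $p_\pm\ge 0$ such that $\mathbb{P}(|X|>x)=L(x)x^{-2}$ for $x>0$ and $\mathbb{P}(\pm X>x)/\mathbb{P}(|X|>x)\to p_\pm$ as $x\to\infty$; and (ii) there exist a random variable $Y_2$ with $\mathbb{P}(Y_2>x)=x^{-2}$, $x>1$, and a sequence of random variables $(\Theta_t)_{t\in\mathbb{Z}}$ independent of $Y_2$ such that for every $h\ge 0$, $$\mathbb{P}\big(x^{-1}(X_{-h},\ldots,X_h)\in\cdot\ \big|\ |X_0|>x\big)\ \stackrel{w}{\to}\ \mathbb{P}\big(Y_2(\Theta_{-h},\ldots,\Theta_h)\in\cdot\big),\qquad x\to\infty .$$ The process $(\Theta_t)$ is called the spectral tail process of $(X_t)$. For an $m$-dependent sequence $\Theta_t=0$ for $|t|>m$. The sequence $(a_n)$ is uniquely defined by its equation for all sufficiently large $n$. *)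

theory Defs
  imports "HOL-Probability.Probability"
begin

definition strictly_stationary :: "'a measure \<Rightarrow> (int \<Rightarrow> 'a \<Rightarrow> real) \<Rightarrow> bool" where
  "strictly_stationary M X \<longleftrightarrow>
     (\<forall>s. distr M (Pi\<^sub>M UNIV (\<lambda>_. borel)) (\<lambda>\<omega> t. X (t + s) \<omega>) =
          distr M (Pi\<^sub>M UNIV (\<lambda>_. borel)) (\<lambda>\<omega> t. X t \<omega>))"

definition m_dependent :: "nat \<Rightarrow> 'a measure \<Rightarrow> (int \<Rightarrow> 'a \<Rightarrow> real) \<Rightarrow> bool" where
  "m_dependent m M X \<longleftrightarrow>
     (\<forall>s. prob_space.indep_var M
        (Pi\<^sub>M {..s} (\<lambda>_. borel)) (\<lambda>\<omega>. \<lambda>t\<in>{..s}. X t \<omega>)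
        (Pi\<^sub>M {s + int m<..} (\<lambda>_. borel)) (\<lambda>\<omega>. \<lambda>t\<in>{s + int m<..}. X t \<omega>))"

definition slowly_varying :: "(real \<Rightarrow> real) \<Rightarrow> bool" where
  "slowly_varying L \<longleftrightarrow>
     (\<exists>x0>0. (\<forall>x\<ge>x0. L x > 0) \<and> L \<in> borel_measurable (restrict_space borel {x0..})) \<and>
     (\<forall>c>0. ((\<lambda>x. L (c * x) / L x) \<longlongrightarrow> 1) at_top)"

definition regularly_varying_tails :: "real \<Rightarrow> 'a measure \<Rightarrow> ('a \<Rightarrow> real) \<Rightarrow> bool" where
  "regularly_varying_tails \<alpha> M Z \<longleftrightarrow>
     (\<exists>L. slowly_varying L \<and>
        (\<forall>x>0. measure M {\<omega> \<in> space M. \<bar>Z \<omega>\<bar> > x} = L x * x powr (-\<alpha>))) \<and>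
     (\<exists>p q. p \<ge> 0 \<and> q \<ge> 0 \<and>
        ((\<lambda>x. measure M {\<omega> \<in> space M. Z \<omega> > x} /
              measure M {\<omega> \<in> space M. \<bar>Z \<omega>\<bar> > x}) \<longlongrightarrow> p) at_top \<and>
        ((\<lambda>x. measure M {\<omega> \<in> space M. - Z \<omega> > x} /
              measure M {\<omega> \<in> space M. \<bar>Z \<omega>\<bar> > x}) \<longlongrightarrow> q) at_top)"

text \<open>The library's \<^const>\<open>weak_conv_m\<close> covers only sequences of measures on the real
  line; here the limit is along an arbitrary filter and the measures live on any topological space.\<close>

definition weak_conv_on ::
    "'b topology \<Rightarrow> ('i \<Rightarrow> 'b measure) \<Rightarrow> 'b measure \<Rightarrow> 'i filter \<Rightarrow> bool" where
  "weak_conv_on T \<mu> \<nu> F \<longleftrightarrow>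
     (\<forall>f. continuous_map T euclideanreal f \<and> bounded (f ` topspace T) \<longrightarrow>
        ((\<lambda>i. integral\<^sup>L (\<mu> i) f) \<longlongrightarrow> integral\<^sup>L \<nu> f) F)"

text \<open>The vector of coordinates \<open>-h, \<dots>, h\<close> is an extensional function on \<open>{-h..h}\<close>,
  so that Euclidean space of dimension \<open>2h + 1\<close> is the finite product over \<open>{-h..h}\<close>.
  Independence of \<open>Y\<close> and \<open>\<Theta>\<close> is that of the generated
  \<open>\<sigma>\<close>-algebras, since \<open>prob_space.indep_var\<close> needs variables of the same type.\<close>

definition spectral_tail_process ::
    "real \<Rightarrow> 'a measure \<Rightarrow> (int \<Rightarrow> 'a \<Rightarrow> real) \<Rightarrow> 'b measure \<Rightarrow> (int \<Rightarrow> 'b \<Rightarrow> real) \<Rightarrow> bool"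
where
  "spectral_tail_process \<alpha> M X N \<Theta> \<longleftrightarrow>
     (\<exists>Y. Y \<in> borel_measurable N \<and>
        (\<forall>x>1. measure N {\<omega> \<in> space N. Y \<omega> > x} = x powr (-\<alpha>)) \<and>
        prob_space.indep_set N
          (sets (vimage_algebra (space N) Y borel))
          (sets (vimage_algebra (space N) (\<lambda>\<omega> t. \<Theta> t \<omega>) (Pi\<^sub>M UNIV (\<lambda>_. borel)))) \<and>
        (\<forall>h\<ge>0. weak_conv_on
           (product_topology (\<lambda>_. euclideanreal) {-h..h})
           (\<lambda>x::real. distr (uniform_measure M {\<omega> \<in> space M. \<bar>X 0 \<omega>\<bar> > x})
                  (Pi\<^sub>M {-h..h} (\<lambda>_. borel)) (\<lambda>\<omega>. \<lambda>t\<in>{-h..h}. X t \<omega> / x))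
           (distr N (Pi\<^sub>M {-h..h} (\<lambda>_. borel)) (\<lambda>\<omega>. \<lambda>t\<in>{-h..h}. Y \<omega> * \<Theta> t \<omega>))
           at_top))"

definition regularly_varying ::
    "real \<Rightarrow> 'a measure \<Rightarrow> (int \<Rightarrow> 'a \<Rightarrow> real) \<Rightarrow> 'b measure \<Rightarrow> (int \<Rightarrow> 'b \<Rightarrow> real) \<Rightarrow> bool"
where
  "regularly_varying \<alpha> M X N \<Theta> \<longleftrightarrow>
     regularly_varying_tails \<alpha> M (X 0) \<and> spectral_tail_process \<alpha> M X N \<Theta>"

end

theory Submission
  imports Defs
begin

text \<open>
The proof works with \<open>U x = E[min (X\<^sup>2) (x\<^sup>2)]\<close> (called \<open>trunc\<close> below), for which the equation defining
\<open>a n\<close> reads \<open>n * U (a n) = (a n)\<^sup>2\<close>. The function \<open>U\<close> tends to infinity because the variance is infinite. It is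
slowly varying, and \<open>x\<^sup>2 P(|X| > x)\<close> is negligible compared with \<open>U x\<close> (\<open>tail_negligible\<close>). Hence, for a
fixed block length, the exact form of any truncation at a multiple of \<open>a n\<close> is irrelevant for second moments. The
layer-cake representation \<open>U x = \<integral>\<^sub>0\<^sup>x 2 u P(|X| > u) du\<close> transfers limits conditional on \<open>|X 0| > u\<close> to limits
weighted by truncated squares: \<open>E[min ((X t)\<^sup>2) (x\<^sup>2) f(path seen from t, divided by |X t|)] / U x\<close> tends to
\<open>E[f(\<Theta>)]\<close> for bounded continuous \<open>f\<close> (\<open>truncated_spectral_limit\<close>).

For a block of fixed length \<open>r\<close> with sum \<open>S\<close>, the identity
\<open>S\<^sup>2 = (\<Sum>t. (X t)\<^sup>2) * (S\<^sup>2 / (\<Sum>j. (X j)\<^sup>2))\<close> presents \<open>S\<^sup>2\<close> as a sum of squares \<open>(X t)\<^sup>2\<close> weighted by a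
bounded functional that is homogeneous of degree 0. So \<open>E[S\<^sup>2 1(|S| \<le> \<epsilon> x)] / U x\<close> converges to a sum over
\<open>t = 1, \<dots>, r\<close> of expectations of \<open>(\<Sum>j. \<Theta> j)\<^sup>2 / (\<Sum>j. (\<Theta> j)\<^sup>2)\<close>, with \<open>j\<close> ranging over the block as
seen from \<open>t\<close> (\<open>block_second_moment_limit\<close>). By m-dependence \<open>\<Theta> j = 0\<close> for \<open>|j| > m\<close>; hence all but \<open>2 m\<close>
of these terms coincide with \<open>E[W]\<close>, where \<open>W\<close> is the ratio formed with all indices, and the limit divided by
\<open>r\<close> tends to \<open>E[W]\<close> (\<open>block_limit_average\<close>).

That \<open>E[W]\<close> is the constant of the theorem is a consequence of the time-change formula for \<open>\<Theta>\<close>, which follows from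
\<open>truncated_spectral_limit\<close> and stationarity (\<open>time_change\<close>). On the event \<open>A\<close> that \<open>\<Theta>\<close> vanishes at
\<open>-1, \<dots>, -m\<close> one has \<open>(\<Sum>t. \<Theta> t)\<^sup>2 = (\<Sum>s=0..m. (\<Theta> s)\<^sup>2 W)\<close>, and a shift by \<open>s\<close> turns \<open>E[(\<Theta> s)\<^sup>2 W 1(A)]\<close> into the
expectation of \<open>W\<close> on the event that \<open>- s\<close> is the first nonzero index; these events almost surely partition
the space (\<open>cluster_variance\<close>).

Finally, the squared mean of a truncated normalised block sum is at most \<open>(r E|X| / a n)\<^sup>2\<close>, and
\<open>n / (a n)\<^sup>2 = 1 / U (a n)\<close> tends to 0, so variances may be replaced by second moments. The convergence for fixed
\<open>r\<close> is locally uniform in \<open>\<epsilon>\<close> by monotonicity, and a diagonal argument yields \<open>\<rho>\<close> (\<open>diagonal_thresholds\<close>).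
\<close>

section \<open>Truncated second moments\<close>

lemma integral_two_u_Icc:
  fixes b :: real
  assumes "0 \<le> b"
  shows "integrable lborel (\<lambda>u. indicator {0..b} u * (2 * u))"
    and "(\<integral>u. indicator {0..b} u * (2 * u) \<partial>lborel) = b\<^sup>2"
proof -
  have "has_bochner_integral lborel (\<lambda>u. (2 * u) * indicator {0..b} u) (b\<^sup>2 - 0\<^sup>2)"
    by (rule has_bochner_integral_FTC_Icc_real[where F = "\<lambda>u. u\<^sup>2"])
       (use assms in \<open>auto intro!: derivative_eq_intros continuous_intros\<close>)
  then show "integrable lborel (\<lambda>u. indicator {0..b} u * (2 * u))"
    and "(\<integral>u. indicator {0..b} u * (2 * u) \<partial>lborel) = b\<^sup>2"
    by (simp_all add: has_bochner_integral_iff mult.commute)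
qed

lemma (in prob_space) bounded_expectation:
  fixes f :: "'a \<Rightarrow> real"
  assumes [measurable]: "f \<in> borel_measurable M" and B: "\<And>\<omega>. \<omega> \<in> space M \<Longrightarrow> \<bar>f \<omega>\<bar> \<le> B"
  shows "integrable M f" and "\<bar>expectation f\<bar> \<le> B"
proof -
  show int: "integrable M f"
    using B by (intro integrable_const_bound[where B = B]) auto
  have "\<bar>expectation f\<bar> \<le> expectation (\<lambda>\<omega>. \<bar>f \<omega>\<bar>)" by (rule integral_abs_bound)
  also have "\<dots> \<le> expectation (\<lambda>_. B)" using int B by (intro integral_mono) auto
  finally show "\<bar>expectation f\<bar> \<le> B" by (simp add: prob_space)
qed

text \<open>Fubini applied to \<open>min z\<^sup>2 x\<^sup>2 = \<integral>\<^sub>0\<^sup>x 2 u 1(u < |z|) du\<close>. It turns truncated second moments into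
integrals of exceedance probabilities, which is where regular variation gives information.\<close>

lemma (in prob_space) layer_cake:
  fixes Z G :: "'a \<Rightarrow> real" and x :: real
  assumes [measurable]: "Z \<in> borel_measurable M" "G \<in> borel_measurable M"
    and C: "\<And>\<omega>. \<bar>G \<omega>\<bar> \<le> C" and "0 \<le> x"
  shows "integrable lborel
      (\<lambda>u. indicator {0..x} u * (2 * u * expectation (\<lambda>\<omega>. G \<omega> * of_bool (u < \<bar>Z \<omega>\<bar>))))"
    and "expectation (\<lambda>\<omega>. min ((Z \<omega>)\<^sup>2) (x\<^sup>2) * G \<omega>) =
      (\<integral>u. indicator {0..x} u * (2 * u * expectation (\<lambda>\<omega>. G \<omega> * of_bool (u < \<bar>Z \<omega>\<bar>))) \<partial>lborel)"
proof -
  interpret P: pair_sigma_finite M lborel ..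
  define f where "f = (\<lambda>\<omega> u. indicator {0..x} u * (2 * u * (G \<omega> * of_bool (u < \<bar>Z \<omega>\<bar>))))"
  have C0: "0 \<le> C" using C[of undefined] by linarith
  have int: "integrable (M \<Otimes>\<^sub>M lborel) (case_prod f)"
  proof (rule integrableI_bounded_set[where A = "space M \<times> {0..x}" and B = "2 * x * C"])
    show "emeasure (M \<Otimes>\<^sub>M lborel) (space M \<times> {0..x}) < \<infinity>"
      using \<open>0 \<le> x\<close> by (subst lborel.emeasure_pair_measure_Times)
        (auto simp: emeasure_space_1)
    have "\<bar>f \<omega> u\<bar> \<le> 2 * x * C" for \<omega> u
      unfolding f_def using C[of \<omega>] C0 \<open>0 \<le> x\<close>
      by (auto simp: indicator_def abs_mult intro!: mult_mono)
    then show "AE y in M \<Otimes>\<^sub>M lborel. y \<in> space M \<times> {0..x} \<longrightarrow>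
        norm (case y of (\<omega>, u) \<Rightarrow> f \<omega> u) \<le> 2 * x * C"
      by auto
    show "AE y in M \<Otimes>\<^sub>M lborel. y \<notin> space M \<times> {0..x} \<longrightarrow> (case y of (\<omega>, u) \<Rightarrow> f \<omega> u) = 0"
      by (rule AE_I2) (auto simp: f_def space_pair_measure indicator_def)
  qed (auto simp: f_def)
  have inner: "(\<integral>\<omega>. f \<omega> u \<partial>M) =
      indicator {0..x} u * (2 * u * expectation (\<lambda>\<omega>. G \<omega> * of_bool (u < \<bar>Z \<omega>\<bar>)))" for u
    by (simp add: f_def)
  have outer: "(\<integral>u. f \<omega> u \<partial>lborel) = min ((Z \<omega>)\<^sup>2) (x\<^sup>2) * G \<omega>" for \<omega>
  proof -
    define b where "b = min \<bar>Z \<omega>\<bar> x"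
    have b: "0 \<le> b" using \<open>0 \<le> x\<close> by (simp add: b_def)
    have "AE u in lborel. u \<noteq> b" by (rule AE_lborel_singleton)
    then have "(\<integral>u. f \<omega> u \<partial>lborel) = (\<integral>u. G \<omega> * (indicator {0..b} u * (2 * u)) \<partial>lborel)"
      by (intro integral_cong_AE) (auto simp: f_def b_def indicator_def elim!: eventually_mono)
    also have "\<dots> = G \<omega> * b\<^sup>2" by (simp add: integral_two_u_Icc b)
    also have "b\<^sup>2 = min ((Z \<omega>)\<^sup>2) (x\<^sup>2)"
    proof (cases "\<bar>Z \<omega>\<bar> \<le> x")
      case True
      then have "(Z \<omega>)\<^sup>2 \<le> x\<^sup>2" by (metis abs_ge_zero power2_abs power_mono)
      with True show ?thesis by (simp add: b_def)
    next
      case False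
      then have "x\<^sup>2 \<le> (Z \<omega>)\<^sup>2" using \<open>0 \<le> x\<close> by (metis linorder_linear power2_abs power_mono)
      with False show ?thesis by (simp add: b_def)
    qed
    finally show ?thesis by simp
  qed
  show "integrable lborel
      (\<lambda>u. indicator {0..x} u * (2 * u * expectation (\<lambda>\<omega>. G \<omega> * of_bool (u < \<bar>Z \<omega>\<bar>))))"
    using P.integrable_snd[OF int] by (simp add: inner)
  show "expectation (\<lambda>\<omega>. min ((Z \<omega>)\<^sup>2) (x\<^sup>2) * G \<omega>) =
      (\<integral>u. indicator {0..x} u * (2 * u * expectation (\<lambda>\<omega>. G \<omega> * of_bool (u < \<bar>Z \<omega>\<bar>))) \<partial>lborel)"
    using P.Fubini_integral[OF int] by (simp add: inner outer)
qed

text \<open>This lemma takes the place of Karamata's theorem at the boundary index 2. By the layer-cake formula both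
moments are integrals of \<open>2 u\<close> against exceedance functions; if the ratio of the integrands
tends to \<open>c\<close> and the integral in the denominator diverges, then the ratio of the integrals tends
to \<open>c\<close>, because the contribution of any bounded range of \<open>u\<close> is negligible.\<close>

lemma (in prob_space) truncated_moment_ratio:
  fixes Z G Z' :: "'a \<Rightarrow> real"
  assumes [measurable]: "Z \<in> borel_measurable M" "G \<in> borel_measurable M" "Z' \<in> borel_measurable M"
    and C: "\<And>\<omega>. \<bar>G \<omega>\<bar> \<le> C"
    and pos: "\<forall>\<^sub>F u in at_top. 0 < expectation (\<lambda>\<omega>. of_bool (u < \<bar>Z' \<omega>\<bar>) :: real)"
    and lim: "((\<lambda>u. expectation (\<lambda>\<omega>. G \<omega> * of_bool (u < \<bar>Z \<omega>\<bar>)) /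
                  expectation (\<lambda>\<omega>. of_bool (u < \<bar>Z' \<omega>\<bar>))) \<longlongrightarrow> c) at_top"
    and inf: "filterlim (\<lambda>x. expectation (\<lambda>\<omega>. min ((Z' \<omega>)\<^sup>2) (x\<^sup>2))) at_top at_top"
  shows "((\<lambda>x. expectation (\<lambda>\<omega>. min ((Z \<omega>)\<^sup>2) (x\<^sup>2) * G \<omega>) /
              expectation (\<lambda>\<omega>. min ((Z' \<omega>)\<^sup>2) (x\<^sup>2))) \<longlongrightarrow> c) at_top"
proof (rule tendstoI)
  fix e :: real assume "0 < e"
  define F where "F u = expectation (\<lambda>\<omega>. G \<omega> * of_bool (u < \<bar>Z \<omega>\<bar>))" for u
  define T :: "real \<Rightarrow> real" where "T u = expectation (\<lambda>\<omega>. of_bool (u < \<bar>Z' \<omega>\<bar>))" for u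
  define I where "I x = expectation (\<lambda>\<omega>. min ((Z \<omega>)\<^sup>2) (x\<^sup>2) * G \<omega>)" for x
  define J where "J x = expectation (\<lambda>\<omega>. min ((Z' \<omega>)\<^sup>2) (x\<^sup>2))" for x
  define A where "A = C + \<bar>c\<bar>"
  have C0: "0 \<le> C" using C[of undefined] by linarith
  have T: "0 \<le> T u" "T u \<le> 1" for u
    unfolding T_def using bounded_expectation(2)[of "\<lambda>\<omega>. of_bool (u < \<bar>Z' \<omega>\<bar>)" 1] by auto
  have F: "\<bar>F u\<bar> \<le> C" for u
    unfolding F_def using C C0 by (intro bounded_expectation) (auto simp: of_bool_def)
  have "\<forall>\<^sub>F u in at_top. \<bar>F u - c * T u\<bar> \<le> e / 2 * T u"
    using tendstoD[OF lim half_gt_zero[OF \<open>0 < e\<close>]] pos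
  proof eventually_elim
    case (elim u)
    then have "\<bar>F u / T u - c\<bar> < e / 2" "0 < T u" by (auto simp: dist_real_def F_def T_def)
    moreover have "F u - c * T u = (F u / T u - c) * T u" using \<open>0 < T u\<close> by (simp add: field_simps)
    ultimately show ?case by (simp add: abs_mult mult_right_mono)
  qed
  then obtain u1 where "\<And>u. u1 \<le> u \<Longrightarrow> \<bar>F u - c * T u\<bar> \<le> e / 2 * T u"
    by (auto simp: eventually_at_top_linorder)
  then obtain u0 where u0: "\<And>u. u0 \<le> u \<Longrightarrow> \<bar>F u - c * T u\<bar> \<le> e / 2 * T u" and "0 \<le> u0"
    using that[of "max u1 0"] by simp
  \<comment> \<open>Beyond \<open>u0\<close> the integrands differ by at most \<open>e / 2\<close> times the denominator;
    below \<open>u0\<close> they are bounded, which costs only the constant \<open>A * u0\<^sup>2\<close>.\<close>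
  have bound: "\<bar>I x - c * J x\<bar> \<le> e / 2 * J x + A * u0\<^sup>2" if "0 \<le> x" for x
  proof -
    note IG = layer_cake[OF assms(1,2) C that, folded F_def I_def]
    note IT = layer_cake[OF assms(3), of "\<lambda>_. 1" 1 x, OF _ _ that, simplified, folded T_def J_def]
    have eq: "I x - c * J x = (\<integral>u. indicator {0..x} u * (2 * u * F u) - c * (indicator {0..x} u * (2 * u * T u)) \<partial>lborel)"
      using IG IT by simp
    have "\<bar>I x - c * J x\<bar> \<le> (\<integral>u. e / 2 * (indicator {0..x} u * (2 * u * T u)) + A * (indicator {0..u0} u * (2 * u)) \<partial>lborel)"
    unfolding eq
    proof (rule order_trans[OF integral_abs_bound], rule integral_mono)
      fix u :: real
      have "\<bar>F u - c * T u\<bar> \<le> A"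
      proof -
        have "\<bar>c * T u\<bar> \<le> \<bar>c\<bar>"
          using T[of u] by (simp add: abs_mult mult_left_le)
        then show ?thesis using F[of u] unfolding A_def by linarith
      qed
      moreover have "0 \<le> e / 2 * T u" using \<open>0 < e\<close> T by simp
      ultimately have *: "\<bar>F u - c * T u\<bar> \<le> e / 2 * T u + A * indicator {..u0} u"
        using u0[of u] by (auto simp: indicator_def)
      show "\<bar>indicator {0..x} u * (2 * u * F u) - c * (indicator {0..x} u * (2 * u * T u))\<bar>
          \<le> e / 2 * (indicator {0..x} u * (2 * u * T u)) + A * (indicator {0..u0} u * (2 * u))"
      proof (cases "u \<in> {0..x}")
        case True
        then have "\<bar>2 * u * (F u - c * T u)\<bar> \<le> 2 * u * (e / 2 * T u + A * indicator {..u0} u)"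
          using * by (simp add: abs_mult mult_left_mono)
        with True show ?thesis by (auto simp: indicator_def algebra_simps)
      next
        case False
        then show ?thesis using C0 by (auto simp: indicator_def A_def)
      qed
    qed (intro integrable_abs Bochner_Integration.integrable_add Bochner_Integration.integrable_diff
        integrable_mult_right IG(1) IT(1) integral_two_u_Icc(1) \<open>0 \<le> u0\<close>)+
    also have "\<dots> = e / 2 * J x + A * u0\<^sup>2"
      by (subst Bochner_Integration.integral_add)
        (simp_all only: integral_mult_right_zero IT integral_two_u_Icc \<open>0 \<le> u0\<close> integrable_mult_right)
    finally show ?thesis .
  qed
  have "\<forall>\<^sub>F x in at_top. 2 * A * u0\<^sup>2 / e + 1 < J x"
    using inf by (simp add: filterlim_at_top_dense J_def)
  then show "\<forall>\<^sub>F x in at_top. dist (expectation (\<lambda>\<omega>. min ((Z \<omega>)\<^sup>2) (x\<^sup>2) * G \<omega>) /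
      expectation (\<lambda>\<omega>. min ((Z' \<omega>)\<^sup>2) (x\<^sup>2))) c < e"
    using eventually_ge_at_top[of 0]
  proof eventually_elim
    case (elim x)
    have "0 \<le> 2 * A * u0\<^sup>2 / e" using \<open>0 < e\<close> C0 by (simp add: A_def)
    then have J: "0 < J x" using elim by linarith
    have "A * u0\<^sup>2 < e / 2 * J x"
    proof -
      have "2 * A * u0\<^sup>2 / e < J x" using elim by linarith
      then show ?thesis using \<open>0 < e\<close> by (simp add: field_simps)
    qed
    then have "\<bar>I x - c * J x\<bar> < e * J x" using bound[OF elim(2)] by linarith
    moreover have "I x / J x - c = (I x - c * J x) / J x" using J by (simp add: field_simps)
    ultimately have "\<bar>I x / J x - c\<bar> < e" using J by (simp add: abs_divide pos_divide_less_eq)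
    then show ?case by (simp add: dist_real_def I_def J_def)
  qed
qed

section \<open>Heavy-tailed stationary sequences\<close>

lemma (in prob_space) integral_uniform_measure:
  fixes f :: "'a \<Rightarrow> real"
  assumes [measurable]: "A \<in> events" "f \<in> borel_measurable M" and "0 < prob A"
  shows "integral\<^sup>L (uniform_measure M A) f = expectation (\<lambda>\<omega>. f \<omega> * indicator A \<omega>) / prob A"
proof -
  have "uniform_measure M A = density M (\<lambda>\<omega>. ennreal (indicator A \<omega> / prob A))"
    unfolding uniform_measure_def
    using \<open>0 < prob A\<close> by (intro arg_cong[where f = "density M"] ext)
      (auto simp: emeasure_eq_measure divide_ennreal indicator_def simp flip: ennreal_1)
  also have "integral\<^sup>L \<dots> f = expectation (\<lambda>\<omega>. (indicator A \<omega> / prob A) *\<^sub>R f \<omega>)"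
    using \<open>0 < prob A\<close> by (intro integral_density) auto
  also have "\<dots> = expectation (\<lambda>\<omega>. f \<omega> * indicator A \<omega> / prob A)"
    by (intro Bochner_Integration.integral_cong) auto
  finally show ?thesis by simp
qed

text \<open>Continuity refers to the product topology on bi-infinite paths, so that continuity and Borel measurability of
concrete functionals come from the type classes; the window condition lets such a functional be evaluated
on the finite coordinate vectors that occur in the definition of the spectral tail process.\<close>

definition window_continuous :: "int \<Rightarrow> ((int \<Rightarrow> real) \<Rightarrow> real) \<Rightarrow> bool" where
  "window_continuous h f \<longleftrightarrow>
     continuous_on UNIV f \<and> (\<forall>v w. (\<forall>j\<in>{-h..h}. v j = w j) \<longrightarrow> f v = f w)"

lemma borel_measurable_paths:
  fixes V :: "int \<Rightarrow> 'a \<Rightarrow> real"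
  assumes "\<And>t. V t \<in> borel_measurable M" "f \<in> borel_measurable borel"
  shows "(\<lambda>\<omega>. f (\<lambda>t. V t \<omega>)) \<in> borel_measurable M"
proof -
  have "(\<lambda>\<omega> t. V t \<omega>) \<in> measurable M (Pi\<^sub>M UNIV (\<lambda>_. borel))"
    using assms(1) by (intro measurable_PiM_single') auto
  then have "(\<lambda>\<omega> t. V t \<omega>) \<in> borel_measurable M"
    using measurable_cong_sets[OF refl sets_PiM_equal_borel] by blast
  from measurable_compose[OF this assms(2)] show ?thesis .
qed

lemma window_functional_measurable:
  assumes "window_continuous h f"
  shows "f \<in> borel_measurable borel"
  using assms unfolding window_continuous_def by (intro borel_measurable_continuous_onI) blast

text \<open>The locale fixes one witness \<open>Y\<close> for the existential quantifier in the definition of the spectral tail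
process, and spells out the conditions on it.\<close>

locale heavy_tailed_sequence = M: prob_space M + N: prob_space N
  for M :: "'a measure" and N :: "'b measure" +
  fixes X :: "int \<Rightarrow> 'a \<Rightarrow> real" and \<Theta> :: "int \<Rightarrow> 'b \<Rightarrow> real" and Y :: "'b \<Rightarrow> real"
  assumes X_meas [measurable]: "\<And>t. X t \<in> borel_measurable M"
    and \<Theta>_meas [measurable]: "\<And>t. \<Theta> t \<in> borel_measurable N"
    and Y_meas [measurable]: "Y \<in> borel_measurable N"
    and stationary: "strictly_stationary M X"
    and tails: "regularly_varying_tails 2 M (X 0)"
    and infinite_variance: "(\<integral>\<^sup>+ \<omega>. ennreal ((X 0 \<omega>)\<^sup>2) \<partial>M) = \<infinity>"
    and Y_tail: "\<And>x. 1 < x \<Longrightarrow> measure N {\<omega> \<in> space N. x < Y \<omega>} = x powr (-2)"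
    and Y_indep: "N.indep_set
        (sets (vimage_algebra (space N) Y borel))
        (sets (vimage_algebra (space N) (\<lambda>\<omega> t. \<Theta> t \<omega>) (Pi\<^sub>M UNIV (\<lambda>_. borel))))"
    and spectral: "\<And>h::int. 0 \<le> h \<Longrightarrow> weak_conv_on
        (product_topology (\<lambda>_. euclideanreal) {-h..h})
        (\<lambda>x::real. distr (uniform_measure M {\<omega> \<in> space M. \<bar>X 0 \<omega>\<bar> > x})
               (Pi\<^sub>M {-h..h} (\<lambda>_. borel)) (\<lambda>\<omega>. \<lambda>t\<in>{-h..h}. X t \<omega> / x))
        (distr N (Pi\<^sub>M {-h..h} (\<lambda>_. borel)) (\<lambda>\<omega>. \<lambda>t\<in>{-h..h}. Y \<omega> * \<Theta> t \<omega>))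
        at_top"
begin

definition tail :: "real \<Rightarrow> real" where
  "tail u = M.expectation (\<lambda>\<omega>. of_bool (u < \<bar>X 0 \<omega>\<bar>))"

text \<open>In terms of \<open>trunc\<close> the equation that defines the norming sequence reads \<open>n * trunc (a n) = (a n)\<^sup>2\<close>,
see \<open>trunc_eq\<close> below; all limits are therefore taken relative to \<open>trunc\<close>.\<close>

definition trunc :: "real \<Rightarrow> real" where
  "trunc x = M.expectation (\<lambda>\<omega>. min ((X 0 \<omega>)\<^sup>2) (x\<^sup>2))"

lemma tail_eq_prob: "tail u = M.prob {\<omega> \<in> space M. u < \<bar>X 0 \<omega>\<bar>}"
proof -
  have "tail u = M.expectation (indicator {\<omega> \<in> space M. u < \<bar>X 0 \<omega>\<bar>})"
    unfolding tail_def by (intro Bochner_Integration.integral_cong) (auto simp: indicator_def)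
  then show ?thesis by simp
qed

lemma tail_antimono: "u \<le> v \<Longrightarrow> tail v \<le> tail u"
  unfolding tail_eq_prob by (intro M.finite_measure_mono) auto

lemma tail_slowly_varying:
  obtains L where "slowly_varying L" "\<And>x. 0 < x \<Longrightarrow> tail x = L x * x powr (-2)"
  using tails unfolding regularly_varying_tails_def tail_eq_prob by auto

lemma tail_pos: "0 < tail u"
proof -
  obtain L where L: "slowly_varying L" "\<And>x. 0 < x \<Longrightarrow> tail x = L x * x powr (-2)"
    by (rule tail_slowly_varying) auto
  then obtain x0 where "0 < x0" "\<And>x. x0 \<le> x \<Longrightarrow> 0 < L x" unfolding slowly_varying_def by auto
  then have "0 < tail (max x0 u)" using L(2)[of "max x0 u"] by (simp add: less_max_iff_disj)
  also have "\<dots> \<le> tail u" by (rule tail_antimono) simp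
  finally show ?thesis .
qed

lemma tail_scale:
  assumes "0 < c"
  shows "((\<lambda>x. tail (c * x) / tail x) \<longlongrightarrow> 1 / c\<^sup>2) at_top"
proof -
  obtain L where L: "slowly_varying L" "\<And>x. 0 < x \<Longrightarrow> tail x = L x * x powr (-2)"
    by (rule tail_slowly_varying) auto
  have "((\<lambda>x. L (c * x) / L x * (1 / c\<^sup>2)) \<longlongrightarrow> 1 * (1 / c\<^sup>2)) at_top"
    using L(1) assms unfolding slowly_varying_def by (intro tendsto_mult tendsto_const) auto
  moreover have "\<forall>\<^sub>F x in at_top. L (c * x) / L x * (1 / c\<^sup>2) = tail (c * x) / tail x"
    using eventually_gt_at_top[of 0]
  proof eventually_elim
    case (elim x)
    have "L x = x\<^sup>2 * tail x" "L (c * x) = (c * x)\<^sup>2 * tail (c * x)"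
      using assms elim L(2)[of x] L(2)[of "c * x"] by (simp_all add: powr_minus)
    then show ?case
      using assms elim tail_pos[of x] by (simp add: power_mult_distrib)
  qed
  ultimately show ?thesis by (simp add: filterlim_cong[OF refl refl])
qed

lemma integrable_min_square [simp]:
  "integrable M (\<lambda>\<omega>. min ((X t \<omega>)\<^sup>2) (x\<^sup>2))"
  by (rule M.bounded_expectation[where B = "x\<^sup>2"]) auto

lemma trunc_mono: "0 \<le> x \<Longrightarrow> x \<le> y \<Longrightarrow> trunc x \<le> trunc y"
  unfolding trunc_def by (intro integral_mono min.mono order_refl power_mono) auto

lemma trunc_ge: "x\<^sup>2 * tail x \<le> trunc x" if "0 \<le> x"
proof -
  have "x\<^sup>2 * tail x = M.expectation (\<lambda>\<omega>. x\<^sup>2 * of_bool (x < \<bar>X 0 \<omega>\<bar>))" by (simp add: tail_def)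
  also have "\<dots> \<le> trunc x"
    unfolding trunc_def
  proof (rule integral_mono)
    fix \<omega>
    have "x\<^sup>2 \<le> (X 0 \<omega>)\<^sup>2" if "x < \<bar>X 0 \<omega>\<bar>"
      using power_mono[of x "\<bar>X 0 \<omega>\<bar>" 2] that \<open>0 \<le> x\<close> by simp
    then show "x\<^sup>2 * of_bool (x < \<bar>X 0 \<omega>\<bar>) \<le> min ((X 0 \<omega>)\<^sup>2) (x\<^sup>2)" by auto
  qed (auto intro!: M.bounded_expectation[where B = 1])
  finally show ?thesis .
qed

lemma trunc_pos: "0 < x \<Longrightarrow> 0 < trunc x"
  using trunc_ge[of x] tail_pos[of x] by (smt (verit) zero_less_power zero_less_mult_iff)

lemma trunc_at_top: "filterlim trunc at_top at_top"
proof -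
  have "\<exists>n::nat. B < trunc (real n)" for B
  proof (rule ccontr)
    assume "\<nexists>n::nat. B < trunc (real n)"
    then have B: "trunc (real n) \<le> B" for n :: nat by (auto simp: not_less)
    have "(\<lambda>n. \<integral>\<^sup>+ \<omega>. ennreal (min ((X 0 \<omega>)\<^sup>2) ((real n)\<^sup>2)) \<partial>M) \<longlonglongrightarrow> (\<integral>\<^sup>+ \<omega>. ennreal ((X 0 \<omega>)\<^sup>2) \<partial>M)"
    proof (rule nn_integral_LIMSEQ)
      show "incseq (\<lambda>n \<omega>. ennreal (min ((X 0 \<omega>)\<^sup>2) ((real n)\<^sup>2)))"
        by (intro incseq_SucI le_funI ennreal_leI min.mono order_refl power_mono) auto
      show "(\<lambda>n. ennreal (min ((X 0 \<omega>)\<^sup>2) ((real n)\<^sup>2))) \<longlonglongrightarrow> ennreal ((X 0 \<omega>)\<^sup>2)" for \<omega>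
      proof (rule tendsto_eventually)
        show "\<forall>\<^sub>F n in sequentially. ennreal (min ((X 0 \<omega>)\<^sup>2) ((real n)\<^sup>2)) = ennreal ((X 0 \<omega>)\<^sup>2)"
          using eventually_ge_at_top[of "nat \<lceil>\<bar>X 0 \<omega>\<bar>\<rceil>"]
        proof eventually_elim
          case (elim n)
          then have "\<bar>X 0 \<omega>\<bar> \<le> real n" by linarith
          then have "(X 0 \<omega>)\<^sup>2 \<le> (real n)\<^sup>2" by (metis abs_ge_zero power2_abs power_mono)
          then show ?case by simp
        qed
      qed
    qed auto
    moreover have "(\<integral>\<^sup>+ \<omega>. ennreal (min ((X 0 \<omega>)\<^sup>2) ((real n)\<^sup>2)) \<partial>M) \<le> ennreal B" for n
      using B[of n] by (subst nn_integral_eq_integral) (auto simp: trunc_def intro!: ennreal_leI)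
    ultimately have "(\<integral>\<^sup>+ \<omega>. ennreal ((X 0 \<omega>)\<^sup>2) \<partial>M) \<le> ennreal B"
      by (intro LIMSEQ_le_const2) auto
    then show False using infinite_variance by (auto simp: top_unique)
  qed
  then show ?thesis
    unfolding filterlim_at_top eventually_at_top_linorder
    by (meson less_imp_le of_nat_0_le_iff order_trans trunc_mono)
qed

text \<open>Slow variation of \<open>trunc\<close>. The truncated moment of \<open>X 0 / c\<close> is \<open>trunc (c x) / c\<^sup>2\<close>, and its
exceedance function is asymptotically \<open>1 / c\<^sup>2\<close> times that of \<open>X 0\<close>, so the two powers of \<open>c\<close> cancel.\<close>

lemma trunc_scale:
  assumes "0 < c"
  shows "((\<lambda>x. trunc (c * x) / trunc x) \<longlongrightarrow> 1) at_top"
proof -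
  have E: "min ((X 0 \<omega> / c)\<^sup>2) (x\<^sup>2) = min ((X 0 \<omega>)\<^sup>2) ((c * x)\<^sup>2) / c\<^sup>2" for \<omega> x
    using assms by (simp add: min_divide_distrib_right power_divide power_mult_distrib)
  have B: "u < \<bar>X 0 \<omega> / c\<bar> \<longleftrightarrow> c * u < \<bar>X 0 \<omega>\<bar>" for u \<omega>
    using assms by (simp add: field_simps)
  have "((\<lambda>x. M.expectation (\<lambda>\<omega>. min ((X 0 \<omega> / c)\<^sup>2) (x\<^sup>2) * 1) / trunc x) \<longlongrightarrow> 1 / c\<^sup>2) at_top"
    unfolding trunc_def
  proof (rule M.truncated_moment_ratio[where C = 1])
    show "((\<lambda>u. M.expectation (\<lambda>\<omega>. 1 * of_bool (u < \<bar>X 0 \<omega> / c\<bar>)) / M.expectation (\<lambda>\<omega>. of_bool (u < \<bar>X 0 \<omega>\<bar>)))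
      \<longlongrightarrow> 1 / c\<^sup>2) at_top"
      using tail_scale[OF assms] unfolding B by (simp add: tail_def)
  qed (use tail_pos trunc_at_top in \<open>auto simp: tail_def trunc_def[abs_def]\<close>)
  from tendsto_mult[OF this tendsto_const[of "c\<^sup>2"]] assms
  show ?thesis unfolding E by (simp add: trunc_def)
qed

text \<open>Between \<open>x / 2\<close> and \<open>x\<close> the function \<open>trunc\<close> grows by at least a multiple of
\<open>x\<^sup>2 * tail x\<close>, and this growth is negligible by slow variation. Every error term below is controlled by
this lemma.\<close>

lemma tail_negligible:
  assumes "0 < d"
  shows "((\<lambda>x. x\<^sup>2 * tail (d * x) / trunc x) \<longlongrightarrow> 0) at_top"
proof -
  \<comment> \<open>On \<open>{x < |X 0|}\<close> the two truncations are exactly \<open>x\<^sup>2\<close> and \<open>(x / 2)\<^sup>2\<close>.\<close>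
  have le: "3 / 4 * x\<^sup>2 * tail x \<le> trunc x - trunc (1 / 2 * x)" if "0 \<le> x" for x
  proof -
    have "3 / 4 * x\<^sup>2 * tail x = M.expectation (\<lambda>\<omega>. 3 / 4 * x\<^sup>2 * of_bool (x < \<bar>X 0 \<omega>\<bar>))"
      by (simp add: tail_def)
    also have "\<dots> \<le> M.expectation (\<lambda>\<omega>. min ((X 0 \<omega>)\<^sup>2) (x\<^sup>2) - min ((X 0 \<omega>)\<^sup>2) ((1 / 2 * x)\<^sup>2))"
    proof (rule integral_mono)
      fix \<omega>
      have half: "min ((X 0 \<omega>)\<^sup>2) ((1 / 2 * x)\<^sup>2) \<le> min ((X 0 \<omega>)\<^sup>2) (x\<^sup>2)"
        using \<open>0 \<le> x\<close> by (intro min.mono order_refl power_mono) auto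
      show "3 / 4 * x\<^sup>2 * of_bool (x < \<bar>X 0 \<omega>\<bar>)
          \<le> min ((X 0 \<omega>)\<^sup>2) (x\<^sup>2) - min ((X 0 \<omega>)\<^sup>2) ((1 / 2 * x)\<^sup>2)"
      proof (cases "x < \<bar>X 0 \<omega>\<bar>")
        case True
        then have "x\<^sup>2 \<le> (X 0 \<omega>)\<^sup>2" using power_mono[of x "\<bar>X 0 \<omega>\<bar>" 2] \<open>0 \<le> x\<close> by simp
        moreover have "min ((X 0 \<omega>)\<^sup>2) ((1 / 2 * x)\<^sup>2) \<le> x\<^sup>2 / 4" by (simp add: power_divide)
        ultimately show ?thesis using True by simp
      qed (use half in simp)
    qed (auto intro!: M.bounded_expectation[where B = "3 / 4 * x\<^sup>2"])
    also have "\<dots> = trunc x - trunc (1 / 2 * x)" by (simp add: trunc_def)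
    finally show ?thesis .
  qed
  have lim1: "((\<lambda>x. x\<^sup>2 * tail x / trunc x) \<longlongrightarrow> 0) at_top"
  proof (rule tendsto_sandwich[where f = "\<lambda>_. 0" and h = "\<lambda>x. 4 / 3 * (1 - trunc (1 / 2 * x) / trunc x)"])
    show "\<forall>\<^sub>F x in at_top. 0 \<le> x\<^sup>2 * tail x / trunc x"
      using eventually_gt_at_top[of 0]
      by eventually_elim (simp add: less_imp_le[OF tail_pos] less_imp_le[OF trunc_pos])
    show "\<forall>\<^sub>F x in at_top. x\<^sup>2 * tail x / trunc x \<le> 4 / 3 * (1 - trunc (1 / 2 * x) / trunc x)"
      using eventually_gt_at_top[of 0]
    proof eventually_elim
      case (elim x)
      with le[of x] trunc_pos[of x] show ?case by (simp add: field_simps)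
    qed
    have "((\<lambda>x. 4 / 3 * (1 - trunc (1 / 2 * x) / trunc x)) \<longlongrightarrow> 4 / 3 * (1 - 1)) at_top"
      by (intro tendsto_intros trunc_scale) simp
    then show "((\<lambda>x. 4 / 3 * (1 - trunc (1 / 2 * x) / trunc x)) \<longlongrightarrow> 0) at_top" by simp
  qed simp
  have "filterlim (\<lambda>x. d * x) at_top at_top"
    using assms by (simp add: filterlim_tendsto_pos_mult_at_top[OF tendsto_const] filterlim_ident)
  from filterlim_compose[OF lim1 this]
  have "((\<lambda>x. (d * x)\<^sup>2 * tail (d * x) / trunc (d * x) * (trunc (d * x) / trunc x) * (1 / d\<^sup>2))
      \<longlongrightarrow> 0 * 1 * (1 / d\<^sup>2)) at_top"
    by (intro tendsto_intros trunc_scale assms)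
  moreover have "\<forall>\<^sub>F x in at_top. (d * x)\<^sup>2 * tail (d * x) / trunc (d * x) * (trunc (d * x) / trunc x) * (1 / d\<^sup>2)
      = x\<^sup>2 * tail (d * x) / trunc x"
    using eventually_gt_at_top[of 0]
    by eventually_elim (use assms trunc_pos in \<open>simp add: field_simps less_imp_neq[symmetric]\<close>)
  ultimately show ?thesis by (simp add: filterlim_cong[OF refl refl])
qed

lemma stationary_expectation:
  fixes g :: "(int \<Rightarrow> real) \<Rightarrow> real"
  assumes "g \<in> borel_measurable borel"
  shows "M.expectation (\<lambda>\<omega>. g (\<lambda>j. X (j + t) \<omega>)) = M.expectation (\<lambda>\<omega>. g (\<lambda>j. X j \<omega>))"
proof -
  let ?P = "Pi\<^sub>M UNIV (\<lambda>_::int. borel :: real measure)"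
  have g: "g \<in> borel_measurable ?P"
    using assms measurable_cong_sets[OF sets_PiM_equal_borel refl] by blast
  have m: "(\<lambda>\<omega> j. X (j + s) \<omega>) \<in> measurable M ?P" for s
    by (intro measurable_PiM_single') auto
  have "M.expectation (\<lambda>\<omega>. g (\<lambda>j. X (j + t) \<omega>)) = integral\<^sup>L (distr M ?P (\<lambda>\<omega> j. X (j + t) \<omega>)) g"
    by (rule integral_distr[OF m g, symmetric])
  also have "\<dots> = integral\<^sup>L (distr M ?P (\<lambda>\<omega> j. X j \<omega>)) g"
    using stationary by (simp add: strictly_stationary_def)
  also have "\<dots> = M.expectation (\<lambda>\<omega>. g (\<lambda>j. X j \<omega>))"
    using integral_distr[OF m[of 0] g] by simp
  finally show ?thesis .
qed

section \<open>The spectral tail process\<close>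

text \<open>The weak convergence in the definition of the spectral tail process, transported from functionals of
restricted coordinate vectors to window-continuous functionals of paths. The map \<open>ext\<close> in the proof extends a
vector by zero; the window condition makes the value of \<open>f\<close> independent of that extension.\<close>

lemma spectral_limit:
  assumes f: "window_continuous h f" and C: "\<And>v. \<bar>f v\<bar> \<le> C"
  shows "((\<lambda>x. M.expectation (\<lambda>\<omega>. f (\<lambda>j. X j \<omega> / x) * of_bool (x < \<bar>X 0 \<omega>\<bar>)) / tail x)
     \<longlongrightarrow> N.expectation (\<lambda>\<omega>. f (\<lambda>j. Y \<omega> * \<Theta> j \<omega>))) at_top"
proof (cases "0 \<le> h")
  case h: True
  let ?I = "{-h..h}" and ?P = "Pi\<^sub>M {-h..h} (\<lambda>_::int. borel :: real measure)"
  define ext where "ext = (\<lambda>(v::int \<Rightarrow> real) j. if j \<in> ?I then v j else 0)"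
  have f_cont: "continuous_on UNIV f" and f_win: "\<And>v w. (\<forall>j\<in>?I. v j = w j) \<Longrightarrow> f v = f w"
    using f unfolding window_continuous_def by blast+
  have f_meas: "f \<in> borel_measurable borel" using f_cont by (rule borel_measurable_continuous_onI)
  have ext_cont: "continuous_map (product_topology (\<lambda>_. euclideanreal) ?I) euclidean ext"
    unfolding euclidean_product_topology[symmetric] continuous_map_componentwise_UNIV ext_def
    by (auto intro: continuous_map_product_projection)
  have fe_cont: "continuous_map (product_topology (\<lambda>_. euclideanreal) ?I) euclideanreal (f \<circ> ext)"
    using f_cont by (intro continuous_map_compose[OF ext_cont]) simp
  have fe_meas: "(f \<circ> ext) \<in> borel_measurable ?P"
  proof -
    have "(\<lambda>v. f (\<lambda>j. ext v j)) \<in> borel_measurable ?P"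
    proof (rule borel_measurable_paths[OF _ f_meas])
      fix t :: int
      show "(\<lambda>v. ext v t) \<in> borel_measurable ?P"
        by (cases "t \<in> ?I") (auto simp: ext_def)
    qed
    then show ?thesis by (simp add: comp_def)
  qed
  have win: "f (ext (restrict v ?I)) = f v" for v
    by (rule f_win) (simp add: ext_def)
  have conv: "((\<lambda>x. integral\<^sup>L (distr (uniform_measure M {\<omega> \<in> space M. \<bar>X 0 \<omega>\<bar> > x}) ?P
                 (\<lambda>\<omega>. \<lambda>t\<in>?I. X t \<omega> / x)) (f \<circ> ext)) \<longlongrightarrow>
        integral\<^sup>L (distr N ?P (\<lambda>\<omega>. \<lambda>t\<in>?I. Y \<omega> * \<Theta> t \<omega>)) (f \<circ> ext)) at_top"
  proof -
    have "bounded ((f \<circ> ext) ` topspace (product_topology (\<lambda>_. euclideanreal) ?I))"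
      using C by (auto simp: bounded_iff)
    with fe_cont show ?thesis using spectral[OF h] unfolding weak_conv_on_def by blast
  qed
  have "integral\<^sup>L (distr N ?P (\<lambda>\<omega>. \<lambda>t\<in>?I. Y \<omega> * \<Theta> t \<omega>)) (f \<circ> ext) =
      N.expectation (\<lambda>\<omega>. f (\<lambda>j. Y \<omega> * \<Theta> j \<omega>))"
    by (subst integral_distr[OF _ fe_meas]) (auto simp: win intro!: measurable_restrict)
  moreover have "integral\<^sup>L (distr (uniform_measure M {\<omega> \<in> space M. \<bar>X 0 \<omega>\<bar> > x}) ?P
                 (\<lambda>\<omega>. \<lambda>t\<in>?I. X t \<omega> / x)) (f \<circ> ext) =
      M.expectation (\<lambda>\<omega>. f (\<lambda>j. X j \<omega> / x) * of_bool (x < \<bar>X 0 \<omega>\<bar>)) / tail x" for x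
  proof -
    have [measurable]: "(\<lambda>\<omega>. f (\<lambda>j. X j \<omega> / x)) \<in> borel_measurable M"
      by (rule borel_measurable_paths[OF _ f_meas]) simp
    have "integral\<^sup>L (distr (uniform_measure M {\<omega> \<in> space M. \<bar>X 0 \<omega>\<bar> > x}) ?P
                 (\<lambda>\<omega>. \<lambda>t\<in>?I. X t \<omega> / x)) (f \<circ> ext) =
        integral\<^sup>L (uniform_measure M {\<omega> \<in> space M. x < \<bar>X 0 \<omega>\<bar>}) (\<lambda>\<omega>. f (\<lambda>j. X j \<omega> / x))"
      by (subst integral_distr[OF _ fe_meas]) (auto simp: win intro!: measurable_restrict)
    also have "\<dots> = M.expectation (\<lambda>\<omega>. f (\<lambda>j. X j \<omega> / x) * indicator {\<omega> \<in> space M. x < \<bar>X 0 \<omega>\<bar>} \<omega>) / tail x"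
      using tail_pos[of x] unfolding tail_eq_prob by (intro M.integral_uniform_measure) auto
    also have "\<dots> = M.expectation (\<lambda>\<omega>. f (\<lambda>j. X j \<omega> / x) * of_bool (x < \<bar>X 0 \<omega>\<bar>)) / tail x"
      by (intro arg_cong2[where f = "(/)"] Bochner_Integration.integral_cong) (auto simp: indicator_def)
    finally show ?thesis .
  qed
  ultimately show ?thesis using conv by simp
next
  case False
  then have "f v = f w" for v w using f by (auto simp: window_continuous_def)
  then obtain c where "\<And>v. f v = c" by metis
  then show ?thesis
    using tail_pos by (simp add: tail_def less_imp_neq[symmetric] N.prob_space)
qed


text \<open>The tail of \<open>Y\<close> is prescribed on \<open>{1<..}\<close> only; letting the argument decrease to 1 shows that no mass
is left elsewhere.\<close>

lemma Y_gt_1: "AE \<omega> in N. 1 < Y \<omega>"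
proof -
  let ?A = "{\<omega> \<in> space N. 1 < Y \<omega>}"
  have "(1 + 1 / real (Suc n)) powr (-2) \<le> N.prob ?A" for n
  proof -
    have "(1 + 1 / real (Suc n)) powr (-2) = N.prob {\<omega> \<in> space N. 1 + 1 / real (Suc n) < Y \<omega>}"
      by (rule Y_tail[symmetric]) simp
    also have "\<dots> \<le> N.prob ?A"
    proof (rule N.finite_measure_mono)
      have "(1::real) \<le> 1 + 1 / real (Suc n)" by simp
      then show "{\<omega> \<in> space N. 1 + 1 / real (Suc n) < Y \<omega>} \<subseteq> ?A"
        by (blast intro: le_less_trans)
    qed simp
    finally show ?thesis .
  qed
  moreover have "(\<lambda>n. (1 + 1 / real (Suc n)) powr (-2)) \<longlonglongrightarrow> (1 + 0) powr (-2)"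
    by (intro tendsto_intros LIMSEQ_Suc[OF lim_1_over_n]) simp
  ultimately have "1 \<le> N.prob ?A"
    by (intro LIMSEQ_le_const2) auto
  then have "N.prob ?A = 1" using N.prob_le_1[of ?A] by linarith
  then have "AE \<omega> in N. \<omega> \<in> ?A" by (subst (asm) N.prob_eq_1) auto
  then show ?thesis by eventually_elim simp
qed

text \<open>The function \<open>max 0 (1 - min 1 |v 0|)\<close> vanishes under all conditional laws, since \<open>|X 0| / x > 1\<close> there,
hence also in the limit.\<close>

lemma Y\<Theta>_ge_1: "AE \<omega> in N. 1 \<le> \<bar>Y \<omega> * \<Theta> 0 \<omega>\<bar>"
proof -
  let ?f = "\<lambda>v :: int \<Rightarrow> real. max 0 (1 - min 1 \<bar>v 0\<bar>)"
  have wc: "window_continuous 0 ?f"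
    unfolding window_continuous_def by (auto intro!: continuous_intros)
  have lim: "((\<lambda>x. M.expectation (\<lambda>\<omega>. ?f (\<lambda>j. X j \<omega> / x) * of_bool (x < \<bar>X 0 \<omega>\<bar>)) / tail x)
     \<longlongrightarrow> N.expectation (\<lambda>\<omega>. ?f (\<lambda>j. Y \<omega> * \<Theta> j \<omega>))) at_top"
    by (rule spectral_limit[OF wc, where C = 1]) auto
  have "\<forall>\<^sub>F x in at_top. M.expectation (\<lambda>\<omega>. ?f (\<lambda>j. X j \<omega> / x) * of_bool (x < \<bar>X 0 \<omega>\<bar>)) / tail x = 0"
    using eventually_gt_at_top[of 0]
  proof eventually_elim
    case (elim x)
    then have "?f (\<lambda>j. X j \<omega> / x) * of_bool (x < \<bar>X 0 \<omega>\<bar>) = 0" for \<omega>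
      by (auto simp: field_simps)
    then show ?case by (simp only: integral_zero div_0)
  qed
  then have "N.expectation (\<lambda>\<omega>. ?f (\<lambda>j. Y \<omega> * \<Theta> j \<omega>)) = 0"
    by (intro tendsto_unique[OF _ lim] tendsto_eventually) simp_all
  then have "AE \<omega> in N. ?f (\<lambda>j. Y \<omega> * \<Theta> j \<omega>) = 0"
    by (subst (asm) integral_nonneg_eq_0_iff_AE) (auto intro!: N.bounded_expectation[where B = 1])
  then show ?thesis by eventually_elim (auto split: if_splits simp: max_def min_def)
qed

text \<open>If \<open>|\<Theta> 0|\<close> fell below some \<open>q < 1\<close> with positive probability, then by independence \<open>Y < 1 / q\<close> would happen
at the same time with positive probability, and \<open>|Y \<Theta> 0|\<close> would be below 1.\<close>

lemma \<Theta>_0_ge_1: "AE \<omega> in N. 1 \<le> \<bar>\<Theta> 0 \<omega>\<bar>"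
proof -
  have null: "AE \<omega> in N. q \<le> \<bar>\<Theta> 0 \<omega>\<bar>" if q: "0 < q" "q < 1" for q :: real
  proof -
    let ?A = "{\<omega> \<in> space N. Y \<omega> < 1 / q}" and ?B = "{\<omega> \<in> space N. \<bar>\<Theta> 0 \<omega>\<bar> < q}"
    have A: "?A \<in> sets (vimage_algebra (space N) Y borel)"
    proof -
      have "?A = Y -` {..<1 / q} \<inter> space N" by auto
      then show ?thesis by (auto intro: in_vimage_algebra)
    qed
    have B: "?B \<in> sets (vimage_algebra (space N) (\<lambda>\<omega> t. \<Theta> t \<omega>) (Pi\<^sub>M UNIV (\<lambda>_. borel)))"
    proof -
      have "?B = (\<lambda>\<omega> t. \<Theta> t \<omega>) -` {v \<in> space (Pi\<^sub>M UNIV (\<lambda>_. borel)). \<bar>v 0\<bar> < q} \<inter> space N"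
        by (auto simp: space_PiM)
      moreover have "{v \<in> space (Pi\<^sub>M UNIV (\<lambda>_::int. borel)). \<bar>v 0\<bar> < q} \<in> sets (Pi\<^sub>M UNIV (\<lambda>_. borel))"
        by measurable
      ultimately show ?thesis by (simp only: in_vimage_algebra)
    qed
    have "N.prob (?A \<inter> ?B) = N.prob ?A * N.prob ?B"
      using Y_indep A B by (rule N.indep_setD)
    moreover have "N.prob (?A \<inter> ?B) = 0"
    proof -
      have "AE \<omega> in N. \<omega> \<notin> ?A \<inter> ?B"
        using Y_gt_1 Y\<Theta>_ge_1
      proof eventually_elim
        case (elim \<omega>)
        have False if "Y \<omega> < 1 / q" "\<bar>\<Theta> 0 \<omega>\<bar> < q"
        proof -
          have "\<bar>Y \<omega> * \<Theta> 0 \<omega>\<bar> = Y \<omega> * \<bar>\<Theta> 0 \<omega>\<bar>" using elim by (simp add: abs_mult)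
          also have "\<dots> \<le> Y \<omega> * q" using elim that by simp
          also have "\<dots> < 1" using q that by (simp add: field_simps)
          finally show False using elim by simp
        qed
        then show ?case by auto
      qed
      then show ?thesis by (subst N.prob_eq_0) auto
    qed
    moreover have "N.prob ?A > 0"
    proof -
      define b where "b = (1 + 1 / q) / 2"
      have b: "1 < b" "b < 1 / q" using q by (auto simp: b_def field_simps)
      have "b powr (-2) < 1" using b by (simp add: powr_less_one)
      moreover have "b powr (-2) = N.prob {\<omega> \<in> space N. b < Y \<omega>}" using Y_tail b by simp
      moreover have "1 \<le> N.prob ?A + N.prob {\<omega> \<in> space N. b < Y \<omega>}"
      proof -
        have "space N \<subseteq> ?A \<union> {\<omega> \<in> space N. b < Y \<omega>}" using b by auto
        then have "1 \<le> N.prob (?A \<union> {\<omega> \<in> space N. b < Y \<omega>})"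
          using N.finite_measure_mono[of "space N" "?A \<union> {\<omega> \<in> space N. b < Y \<omega>}"]
          by (simp add: N.prob_space)
        also have "\<dots> \<le> N.prob ?A + N.prob {\<omega> \<in> space N. b < Y \<omega>}"
          by (rule measure_Un_le) auto
        finally show ?thesis .
      qed
      ultimately show ?thesis by linarith
    qed
    ultimately have "N.prob ?B = 0" by simp
    then have "AE \<omega> in N. \<omega> \<notin> ?B" by (subst (asm) N.prob_eq_0) auto
    then show ?thesis using AE_space by eventually_elim auto
  qed
  have "AE \<omega> in N. \<forall>n::nat. 1 - 1 / real (n + 2) \<le> \<bar>\<Theta> 0 \<omega>\<bar>"
    unfolding AE_all_countable by (intro allI null) (auto simp: field_simps)
  then show ?thesis
  proof eventually_elim
    case (elim \<omega>)
    have "(\<lambda>n. 1 - 1 / real (n + 2)) \<longlonglongrightarrow> 1 - 0"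
      by (intro tendsto_intros LIMSEQ_ignore_initial_segment[OF lim_1_over_n])
    then show ?case using elim by (intro LIMSEQ_le_const2) auto
  qed
qed

text \<open>A continuous ramp from \<open>a\<close> to \<open>b\<close> lies between the indicators of \<open>{b<..}\<close> and \<open>{a<..}\<close>; then \<open>a\<close> tends
to \<open>b\<close>.\<close>

lemma Y\<Theta>_tail_le:
  assumes "1 < b"
  shows "N.prob {\<omega> \<in> space N. b < \<bar>Y \<omega> * \<Theta> 0 \<omega>\<bar>} \<le> 1 / b\<^sup>2"
proof -
  have le: "N.prob {\<omega> \<in> space N. b < \<bar>Y \<omega> * \<Theta> 0 \<omega>\<bar>} \<le> 1 / a\<^sup>2" if a: "1 < a" "a < b" for a
  proof -
    let ?f = "\<lambda>v :: int \<Rightarrow> real. max 0 (min 1 ((\<bar>v 0\<bar> - a) / (b - a)))"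
    have wc: "window_continuous 0 ?f"
      unfolding window_continuous_def using a by (auto intro!: continuous_intros)
    have lim: "((\<lambda>x. M.expectation (\<lambda>\<omega>. ?f (\<lambda>j. X j \<omega> / x) * of_bool (x < \<bar>X 0 \<omega>\<bar>)) / tail x)
       \<longlongrightarrow> N.expectation (\<lambda>\<omega>. ?f (\<lambda>j. Y \<omega> * \<Theta> j \<omega>))) at_top"
      by (rule spectral_limit[OF wc, where C = 1]) auto
    have "\<forall>\<^sub>F x in at_top. M.expectation (\<lambda>\<omega>. ?f (\<lambda>j. X j \<omega> / x) * of_bool (x < \<bar>X 0 \<omega>\<bar>)) / tail x
        \<le> tail (a * x) / tail x"
      using eventually_gt_at_top[of 0]
    proof eventually_elim
      case (elim x)
      have "?f (\<lambda>j. X j \<omega> / x) * of_bool (x < \<bar>X 0 \<omega>\<bar>) \<le> of_bool (a * x < \<bar>X 0 \<omega>\<bar>)" for \<omega>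
      proof (cases "a * x < \<bar>X 0 \<omega>\<bar>")
        case False
        then have "(\<bar>X 0 \<omega> / x\<bar> - a) / (b - a) \<le> 0" using elim a by (simp add: field_simps)
        then show ?thesis by simp
      qed auto
      then have "M.expectation (\<lambda>\<omega>. ?f (\<lambda>j. X j \<omega> / x) * of_bool (x < \<bar>X 0 \<omega>\<bar>)) \<le> tail (a * x)"
        unfolding tail_def by (intro integral_mono) (auto intro!: M.bounded_expectation[where B = 1])
      then show ?case using tail_pos[of x] by (simp add: divide_right_mono)
    qed
    then have "N.expectation (\<lambda>\<omega>. ?f (\<lambda>j. Y \<omega> * \<Theta> j \<omega>)) \<le> 1 / a\<^sup>2"
      using a by (intro tendsto_le[OF _ tail_scale[of a] lim]) auto
    moreover have "N.prob {\<omega> \<in> space N. b < \<bar>Y \<omega> * \<Theta> 0 \<omega>\<bar>} \<le> N.expectation (\<lambda>\<omega>. ?f (\<lambda>j. Y \<omega> * \<Theta> j \<omega>))"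
    proof -
      have "N.prob {\<omega> \<in> space N. b < \<bar>Y \<omega> * \<Theta> 0 \<omega>\<bar>} = N.expectation (indicator {\<omega> \<in> space N. b < \<bar>Y \<omega> * \<Theta> 0 \<omega>\<bar>})"
        by simp
      also have "\<dots> \<le> N.expectation (\<lambda>\<omega>. ?f (\<lambda>j. Y \<omega> * \<Theta> j \<omega>))"
        using a by (intro integral_mono)
          (auto intro!: N.bounded_expectation[where B = 1] simp: indicator_def field_simps)
      finally show ?thesis .
    qed
    ultimately show ?thesis by linarith
  qed
  have lim: "((\<lambda>a. 1 / a\<^sup>2) \<longlongrightarrow> 1 / b\<^sup>2) (at_left b)"
    using assms by (intro tendsto_intros) auto
  have ev: "\<forall>\<^sub>F a in at_left b. N.prob {\<omega> \<in> space N. b < \<bar>Y \<omega> * \<Theta> 0 \<omega>\<bar>} \<le> 1 / a\<^sup>2"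
    unfolding eventually_at_left[OF assms] using assms le by blast
  show ?thesis by (rule tendsto_lowerbound[OF lim ev]) simp
qed

text \<open>Since \<open>|\<Theta> 0| \<ge> 1\<close>, the event \<open>b < Y\<close> is contained in \<open>b < |Y \<Theta> 0|\<close>, whose probability is no larger
than that of \<open>b < Y\<close>. The two events thus agree almost surely for every rational \<open>b > 1\<close>, which forces
\<open>|Y \<Theta> 0| \<le> Y\<close>.\<close>

lemma abs_\<Theta>_0: "AE \<omega> in N. \<bar>\<Theta> 0 \<omega>\<bar> = 1"
proof -
  have le: "AE \<omega> in N. b < \<bar>Y \<omega> * \<Theta> 0 \<omega>\<bar> \<longrightarrow> b < Y \<omega>" if "1 < b" for b
  proof -
    let ?A = "{\<omega> \<in> space N. b < \<bar>Y \<omega> * \<Theta> 0 \<omega>\<bar>}" and ?B = "{\<omega> \<in> space N. b < Y \<omega>}"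
    have "AE \<omega> in N. \<omega> \<in> ?B \<longrightarrow> \<omega> \<in> ?A"
      using Y_gt_1 \<Theta>_0_ge_1
    proof eventually_elim
      case (elim \<omega>)
      then have "Y \<omega> * 1 \<le> Y \<omega> * \<bar>\<Theta> 0 \<omega>\<bar>" by (intro mult_left_mono) auto
      moreover have "\<bar>Y \<omega> * \<Theta> 0 \<omega>\<bar> = Y \<omega> * \<bar>\<Theta> 0 \<omega>\<bar>" using elim by (simp add: abs_mult)
      ultimately show ?case by auto
    qed
    then have "N.prob (?A \<inter> ?B) = N.prob ?B"
      by (intro N.finite_measure_eq_AE) auto
    moreover have "N.prob ?B = 1 / b\<^sup>2" using Y_tail[OF that] that by (simp add: powr_minus field_simps)
    moreover have "N.prob (?A - ?B) = N.prob ?A - N.prob (?A \<inter> ?B)"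
      by (rule N.finite_measure_Diff') auto
    ultimately have "N.prob (?A - ?B) = 0"
      using Y\<Theta>_tail_le[OF that] measure_nonneg[of N "?A - ?B"] by linarith
    then have "AE \<omega> in N. \<omega> \<notin> ?A - ?B" by (subst (asm) N.prob_eq_0) auto
    then show ?thesis using AE_space by eventually_elim auto
  qed
  have "AE \<omega> in N. \<forall>b\<in>\<rat> \<inter> {1<..}. b < \<bar>Y \<omega> * \<Theta> 0 \<omega>\<bar> \<longrightarrow> b < Y \<omega>"
    using le by (subst AE_ball_countable) (auto intro: countable_Int1 countable_rat)
  then show ?thesis using Y_gt_1 \<Theta>_0_ge_1
  proof eventually_elim
    case (elim \<omega>)
    have "\<bar>Y \<omega> * \<Theta> 0 \<omega>\<bar> \<le> Y \<omega>"
    proof (rule ccontr)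
      assume "\<not> ?thesis"
      then obtain b where "b \<in> \<rat>" "Y \<omega> < b" "b < \<bar>Y \<omega> * \<Theta> 0 \<omega>\<bar>"
        using Rats_dense_in_real[of "Y \<omega>" "\<bar>Y \<omega> * \<Theta> 0 \<omega>\<bar>"] by auto
      then show False using elim by fastforce
    qed
    then have "Y \<omega> * \<bar>\<Theta> 0 \<omega>\<bar> \<le> Y \<omega> * 1" using elim by (simp add: abs_mult)
    then have "\<bar>\<Theta> 0 \<omega>\<bar> \<le> 1" using elim by simp
    then show ?case using elim by linarith
  qed
qed

text \<open>The radial variable \<open>Y\<close> disappears when a path is divided by the modulus of its value at 0. Division by
\<open>max 1 |v 0|\<close> does the same under the conditional laws, where \<open>|v 0| > 1\<close>, and is continuous everywhere.\<close>

lemma normalised_spectral_limit: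
  assumes f: "window_continuous h f" and h: "0 \<le> h" and C: "\<And>v. \<bar>v 0\<bar> \<le> 1 \<Longrightarrow> \<bar>f v\<bar> \<le> C"
  shows "((\<lambda>x. M.expectation (\<lambda>\<omega>. f (\<lambda>j. X j \<omega> / \<bar>X 0 \<omega>\<bar>) * of_bool (x < \<bar>X 0 \<omega>\<bar>)) / tail x)
     \<longlongrightarrow> N.expectation (\<lambda>\<omega>. f (\<lambda>j. \<Theta> j \<omega>))) at_top"
proof -
  define g where "g v = f (\<lambda>j. v j / max 1 \<bar>v 0\<bar>)" for v
  have f_meas: "f \<in> borel_measurable borel" by (rule window_functional_measurable[OF f])
  have wc: "window_continuous h g"
    unfolding window_continuous_def
  proof safe
    have "continuous_on UNIV (\<lambda>v (j::int). v j / max 1 \<bar>v 0\<bar> :: real)"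
      by (intro continuous_on_coordinatewise_then_product continuous_intros) auto
    then show "continuous_on UNIV g"
      using f unfolding g_def window_continuous_def
      by (intro continuous_on_compose2[of UNIV f UNIV "\<lambda>v j. v j / max 1 \<bar>v 0\<bar>"]) auto
    fix v w :: "int \<Rightarrow> real" assume "\<forall>j\<in>{-h..h}. v j = w j"
    moreover from this h have "v 0 = w 0" by simp
    ultimately show "g v = g w"
      using f unfolding g_def window_continuous_def by simp
  qed
  have gC: "\<bar>g v\<bar> \<le> C" for v unfolding g_def by (rule C) (auto simp: field_simps max_def)
  have "((\<lambda>x. M.expectation (\<lambda>\<omega>. g (\<lambda>j. X j \<omega> / x) * of_bool (x < \<bar>X 0 \<omega>\<bar>)) / tail x)
     \<longlongrightarrow> N.expectation (\<lambda>\<omega>. g (\<lambda>j. Y \<omega> * \<Theta> j \<omega>))) at_top"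
    by (rule spectral_limit[OF wc gC])
  moreover have "\<forall>\<^sub>F x in at_top.
      M.expectation (\<lambda>\<omega>. g (\<lambda>j. X j \<omega> / x) * of_bool (x < \<bar>X 0 \<omega>\<bar>)) / tail x =
      M.expectation (\<lambda>\<omega>. f (\<lambda>j. X j \<omega> / \<bar>X 0 \<omega>\<bar>) * of_bool (x < \<bar>X 0 \<omega>\<bar>)) / tail x"
    using eventually_gt_at_top[of 0]
  proof eventually_elim
    case (elim x)
    have "g (\<lambda>j. X j \<omega> / x) = f (\<lambda>j. X j \<omega> / \<bar>X 0 \<omega>\<bar>)" if "x < \<bar>X 0 \<omega>\<bar>" for \<omega>
    proof -
      have "max 1 \<bar>X 0 \<omega> / x\<bar> = \<bar>X 0 \<omega>\<bar> / x" using elim that by (simp add: max_def field_simps)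
      then show ?thesis unfolding g_def using elim that by simp
    qed
    then have eq: "g (\<lambda>j. X j \<omega> / x) * of_bool (x < \<bar>X 0 \<omega>\<bar>) =
        f (\<lambda>j. X j \<omega> / \<bar>X 0 \<omega>\<bar>) * of_bool (x < \<bar>X 0 \<omega>\<bar>)" for \<omega> by auto
    show ?case unfolding eq ..
  qed
  moreover have "N.expectation (\<lambda>\<omega>. g (\<lambda>j. Y \<omega> * \<Theta> j \<omega>)) = N.expectation (\<lambda>\<omega>. f (\<lambda>j. \<Theta> j \<omega>))"
  proof (rule integral_cong_AE)
    show "AE \<omega> in N. g (\<lambda>j. Y \<omega> * \<Theta> j \<omega>) = f (\<lambda>j. \<Theta> j \<omega>)"
      using Y_gt_1 abs_\<Theta>_0
    proof eventually_elim
      case (elim \<omega>)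
      then have "max 1 \<bar>Y \<omega> * \<Theta> 0 \<omega>\<bar> = Y \<omega>" by (simp add: abs_mult)
      then show ?case using elim by (simp add: g_def)
    qed
    show "(\<lambda>\<omega>. f (\<lambda>j. \<Theta> j \<omega>)) \<in> borel_measurable N"
      by (rule borel_measurable_paths[OF \<Theta>_meas f_meas])
    show "(\<lambda>\<omega>. g (\<lambda>j. Y \<omega> * \<Theta> j \<omega>)) \<in> borel_measurable N"
      by (rule borel_measurable_paths[OF _ window_functional_measurable[OF wc]]) auto
  qed
  ultimately show ?thesis by (simp add: filterlim_cong[OF refl refl])
qed

text \<open>The main analytic tool: weighted by the truncated square of the value at time \<open>t\<close>, the path seen from \<open>t\<close> and
normalised by its value there behaves like the spectral tail process. A bound on \<open>f\<close> is required only where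
\<open>|v 0| \<le> 1\<close>, as normalised paths (including the zero path that results from division by 0) satisfy this.\<close>

lemma truncated_spectral_limit:
  assumes f: "window_continuous h f" and h: "0 \<le> h" and C: "\<And>v. \<bar>v 0\<bar> \<le> 1 \<Longrightarrow> \<bar>f v\<bar> \<le> C"
  shows "((\<lambda>x. M.expectation (\<lambda>\<omega>. min ((X t \<omega>)\<^sup>2) (x\<^sup>2) * f (\<lambda>j. X (j + t) \<omega> / \<bar>X t \<omega>\<bar>)) / trunc x)
     \<longlongrightarrow> N.expectation (\<lambda>\<omega>. f (\<lambda>j. \<Theta> j \<omega>))) at_top"
proof -
  have f_meas: "f \<in> borel_measurable borel" by (rule window_functional_measurable[OF f])
  have m: "(\<lambda>v. min ((v 0)\<^sup>2) (x\<^sup>2) * f (\<lambda>j. v j / \<bar>v 0\<bar>)) \<in> borel_measurable borel" for x :: real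
    by (intro borel_measurable_times borel_measurable_paths[OF _ f_meas]) (auto intro!: borel_measurable_continuous_onI continuous_intros)
  have "((\<lambda>x. M.expectation (\<lambda>\<omega>. min ((X 0 \<omega>)\<^sup>2) (x\<^sup>2) * f (\<lambda>j. X j \<omega> / \<bar>X 0 \<omega>\<bar>)) / trunc x)
     \<longlongrightarrow> N.expectation (\<lambda>\<omega>. f (\<lambda>j. \<Theta> j \<omega>))) at_top"
    unfolding trunc_def
  proof (rule M.truncated_moment_ratio)
    show "(\<lambda>\<omega>. f (\<lambda>j. X j \<omega> / \<bar>X 0 \<omega>\<bar>)) \<in> borel_measurable M"
      by (rule borel_measurable_paths[OF _ f_meas]) auto
    show "\<bar>f (\<lambda>j. X j \<omega> / \<bar>X 0 \<omega>\<bar>)\<bar> \<le> C" for \<omega>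
      by (rule C) auto
  qed (use normalised_spectral_limit[OF assms] tail_pos trunc_at_top in
      \<open>auto simp: tail_def trunc_def[abs_def]\<close>)
  then show ?thesis
    using stationary_expectation[OF m, where t = t] by simp
qed

end

section \<open>The second moment of a block of fixed length\<close>

text \<open>The maximum with 1 keeps the denominator away
from 0, hence the function continuous; it does not change the value at paths with \<open>|v 0| = 1\<close> if the window
contains 0.\<close>

definition cluster_ratio :: "int \<Rightarrow> int \<Rightarrow> (int \<Rightarrow> real) \<Rightarrow> real" where
  "cluster_ratio a b v = (\<Sum>j=a..b. v j)\<^sup>2 / max 1 (\<Sum>j=a..b. (v j)\<^sup>2)"

lemma cluster_ratio_nonneg [simp]: "0 \<le> cluster_ratio a b v"
  unfolding cluster_ratio_def by simp

lemma cluster_ratio_le: "cluster_ratio a b v \<le> real (card {a..b})"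
proof -
  have "(\<Sum>j=a..b. v j)\<^sup>2 \<le> (\<Sum>j=a..b. (v j)\<^sup>2) * real (card {a..b})"
    by (rule sum_squared_le_sum_of_squares)
  also have "\<dots> \<le> max 1 (\<Sum>j=a..b. (v j)\<^sup>2) * real (card {a..b})"
    by (intro mult_right_mono) auto
  finally show ?thesis
    unfolding cluster_ratio_def by (subst pos_divide_le_eq) (auto simp: mult.commute)
qed

lemma cluster_ratio_measurable [measurable]:
  assumes [measurable]: "\<And>j. V j \<in> borel_measurable M"
  shows "(\<lambda>\<omega>. cluster_ratio a b (\<lambda>j. V j \<omega>)) \<in> borel_measurable M"
  unfolding cluster_ratio_def by measurable

lemma continuous_cluster_ratio: "continuous_on UNIV (cluster_ratio a b)"
proof -
  have "continuous_on UNIV (\<lambda>v. (\<Sum>j=a..b. v j)\<^sup>2 / max 1 (\<Sum>j=a..b. (v j)\<^sup>2) :: real)"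
    by (intro continuous_intros continuous_on_product_coordinates) auto
  then show ?thesis by (simp add: cluster_ratio_def[abs_def])
qed

lemma cluster_ratio_cong:
  assumes "\<And>j. j \<in> {a..b} \<Longrightarrow> v j = w j"
  shows "cluster_ratio a b v = cluster_ratio a b w"
proof -
  have "sum v {a..b} = sum w {a..b}" "(\<Sum>j=a..b. (v j)\<^sup>2) = (\<Sum>j=a..b. (w j)\<^sup>2)"
    using assms by (auto intro: sum.cong)
  then show ?thesis by (simp add: cluster_ratio_def)
qed

lemma window_continuous_cluster_ratio:
  "{a..b} \<subseteq> {-h..h} \<Longrightarrow> window_continuous h (cluster_ratio a b)"
  unfolding window_continuous_def
  by (auto intro!: continuous_cluster_ratio cluster_ratio_cong)

lemma cluster_ratio_normalised:
  assumes "a \<le> 0" "0 \<le> b" "v 0 \<noteq> 0"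
  shows "cluster_ratio a b (\<lambda>j. v j / \<bar>v 0\<bar>) = (\<Sum>j=a..b. v j)\<^sup>2 / (\<Sum>j=a..b. (v j)\<^sup>2)"
proof -
  define Q where "Q = (\<Sum>j=a..b. (v j)\<^sup>2)"
  have "(v 0)\<^sup>2 \<le> Q" unfolding Q_def using assms by (intro member_le_sum) auto
  then have "1 \<le> Q / (v 0)\<^sup>2" using assms(3) by simp
  then have "max 1 (\<Sum>j=a..b. (v j / \<bar>v 0\<bar>)\<^sup>2) = Q / (v 0)\<^sup>2"
    by (simp add: Q_def power_divide sum_divide_distrib)
  moreover have "(\<Sum>j=a..b. v j / \<bar>v 0\<bar>)\<^sup>2 = (\<Sum>j=a..b. v j)\<^sup>2 / (v 0)\<^sup>2"
    by (simp add: power_divide flip: sum_divide_distrib)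
  ultimately show ?thesis using assms(3) by (simp add: cluster_ratio_def Q_def)
qed

lemma sum_shift_int: "(\<Sum>j=a-t..b-t. g (j + t)) = (\<Sum>j=a..(b::int). g j :: real)"
  by (rule sum.reindex_bij_witness[of _ "\<lambda>j. j - t" "\<lambda>j. j + t"]) auto

context heavy_tailed_sequence
begin

lemma expectation_exceedance:
  "M.expectation (\<lambda>\<omega>. of_bool (u < \<bar>X t \<omega>\<bar>)) = tail u"
  using stationary_expectation[of "\<lambda>v. of_bool (u < \<bar>v 0\<bar>)" t]
  by (simp add: tail_def)

text \<open>Write \<open>S\<^sup>2 = (\<Sum>t. (X t)\<^sup>2) * (S\<^sup>2 / (\<Sum>j. (X j)\<^sup>2))\<close>. The second factor is bounded by the block length and
depends only on the path divided by \<open>|X t|\<close>, for any chosen \<open>t\<close>. Replacing \<open>(X t)\<^sup>2\<close> by its truncation at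
\<open>x\<^sup>2\<close>, and dropping the truncation of \<open>S\<close>, changes the expression only if some variable of the block exceeds
a multiple of \<open>x\<close>, and then by at most a multiple of \<open>x\<^sup>2\<close>; by \<open>tail_negligible\<close> this does not matter. Each
remaining term is handled by \<open>truncated_spectral_limit\<close>.\<close>

lemma block_second_moment_limit:
  fixes r :: int
  assumes r: "1 \<le> r" and "0 < \<epsilon>"
  defines "S \<equiv> \<lambda>\<omega>. \<Sum>j=1..r. X j \<omega>"
  shows "((\<lambda>x. M.expectation (\<lambda>\<omega>. (S \<omega>)\<^sup>2 * of_bool (\<bar>S \<omega>\<bar> \<le> \<epsilon> * x)) / trunc x) \<longlongrightarrow>
     (\<Sum>t=1..r. N.expectation (\<lambda>\<omega>. cluster_ratio (1 - t) (r - t) (\<lambda>j. \<Theta> j \<omega>)))) at_top"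
proof -
  define w where "w t \<omega> = cluster_ratio (1 - t) (r - t) (\<lambda>j. X (j + t) \<omega> / \<bar>X t \<omega>\<bar>)" for t \<omega>
  define A where "A x \<omega> = (\<Sum>t=1..r. min ((X t \<omega>)\<^sup>2) (x\<^sup>2) * w t \<omega>)" for x \<omega>
  \<comment> \<open>If all variables of the block are at most \<open>\<delta> * x\<close>, then neither they nor \<open>S\<close> are truncated.\<close>
  define \<delta> where "\<delta> = min 1 (\<epsilon> / r)"
  define K where "K = \<epsilon>\<^sup>2 + r * r"
  have \<delta>: "0 < \<delta>" "\<delta> \<le> 1" "r * \<delta> \<le> \<epsilon>" using assms by (auto simp: \<delta>_def min_def field_simps)
  have w_meas [measurable]: "w t \<in> borel_measurable M" for t
    unfolding w_def by measurable
  have S_meas [measurable]: "S \<in> borel_measurable M" unfolding S_def by measurable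
  have w_le: "0 \<le> w t \<omega>" "w t \<omega> \<le> r" for t \<omega>
    using r cluster_ratio_le[of "1 - t" "r - t"] by (auto simp: w_def)
  have term_le: "\<bar>min ((X t \<omega>)\<^sup>2) (x\<^sup>2) * w t \<omega>\<bar> \<le> x\<^sup>2 * r" for t x \<omega>
    using w_le[of t \<omega>] r by (auto simp: abs_mult intro!: mult_mono)
  have int1: "integrable M (\<lambda>\<omega>. min ((X t \<omega>)\<^sup>2) (x\<^sup>2) * w t \<omega>)" for t x
    by (rule M.bounded_expectation[OF _ term_le]) auto
  have int2: "integrable M (\<lambda>\<omega>. (S \<omega>)\<^sup>2 * of_bool (\<bar>S \<omega>\<bar> \<le> \<epsilon> * x))" for x
  proof (rule M.bounded_expectation[where B = "(\<epsilon> * x)\<^sup>2"])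
    show "\<bar>(S \<omega>)\<^sup>2 * of_bool (\<bar>S \<omega>\<bar> \<le> \<epsilon> * x)\<bar> \<le> (\<epsilon> * x)\<^sup>2" for \<omega>
      using power_mono[of "\<bar>S \<omega>\<bar>" "\<epsilon> * x" 2] by auto
  qed simp
  have limA: "((\<lambda>x. M.expectation (A x) / trunc x) \<longlongrightarrow>
     (\<Sum>t=1..r. N.expectation (\<lambda>\<omega>. cluster_ratio (1 - t) (r - t) (\<lambda>j. \<Theta> j \<omega>)))) at_top"
  proof -
    have "((\<lambda>x. \<Sum>t=1..r. M.expectation (\<lambda>\<omega>. min ((X t \<omega>)\<^sup>2) (x\<^sup>2) * w t \<omega>) / trunc x) \<longlongrightarrow>
       (\<Sum>t=1..r. N.expectation (\<lambda>\<omega>. cluster_ratio (1 - t) (r - t) (\<lambda>j. \<Theta> j \<omega>)))) at_top"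
      unfolding w_def
    proof (intro tendsto_sum truncated_spectral_limit[where h = r])
      show "\<bar>cluster_ratio (1 - t) (r - t) v\<bar> \<le> r" for t v
        using cluster_ratio_le[of "1 - t" "r - t" v] r by simp
    qed (use r in \<open>auto intro!: window_continuous_cluster_ratio\<close>)
    then show ?thesis
      by (simp add: A_def[abs_def] Bochner_Integration.integral_sum int1 sum_divide_distrib)
  qed
  have close: "\<bar>(S \<omega>)\<^sup>2 * of_bool (\<bar>S \<omega>\<bar> \<le> \<epsilon> * x) - A x \<omega>\<bar>
      \<le> K * x\<^sup>2 * (\<Sum>t=1..r. of_bool (\<delta> * x < \<bar>X t \<omega>\<bar>))" if "0 < x" for x \<omega>
  proof (cases "\<exists>t\<in>{1..r}. \<delta> * x < \<bar>X t \<omega>\<bar>")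
    case True
    then obtain t where t: "t \<in> {1..r}" "\<delta> * x < \<bar>X t \<omega>\<bar>" by auto
    have "(1::real) = of_bool (\<delta> * x < \<bar>X t \<omega>\<bar>)" using t by simp
    also have "\<dots> \<le> (\<Sum>t=1..r. of_bool (\<delta> * x < \<bar>X t \<omega>\<bar>))"
      using t(1) by (intro member_le_sum) auto
    finally have one: "(1::real) \<le> (\<Sum>t=1..r. of_bool (\<delta> * x < \<bar>X t \<omega>\<bar>))" .
    have "\<bar>A x \<omega>\<bar> \<le> (\<Sum>t=1..r. x\<^sup>2 * r)"
      unfolding A_def by (rule order_trans[OF sum_abs sum_mono]) (rule term_le)
    also have "\<dots> = r * r * x\<^sup>2" using r by simp
    finally have "\<bar>A x \<omega>\<bar> \<le> r * r * x\<^sup>2" .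
    moreover have "\<bar>(S \<omega>)\<^sup>2 * of_bool (\<bar>S \<omega>\<bar> \<le> \<epsilon> * x)\<bar> \<le> \<epsilon>\<^sup>2 * x\<^sup>2"
      using power_mono[of "\<bar>S \<omega>\<bar>" "\<epsilon> * x" 2] by (auto simp: power_mult_distrib)
    ultimately have "\<bar>(S \<omega>)\<^sup>2 * of_bool (\<bar>S \<omega>\<bar> \<le> \<epsilon> * x) - A x \<omega>\<bar> \<le> K * x\<^sup>2 * 1"
      using abs_triangle_ineq4[of "(S \<omega>)\<^sup>2 * of_bool (\<bar>S \<omega>\<bar> \<le> \<epsilon> * x)" "A x \<omega>"]
      unfolding K_def distrib_right by linarith
    also have "\<dots> \<le> K * x\<^sup>2 * (\<Sum>t=1..r. of_bool (\<delta> * x < \<bar>X t \<omega>\<bar>))"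
      using one r by (intro mult_left_mono) (auto simp: K_def)
    finally show ?thesis .
  next
    case False
    then have small: "\<bar>X t \<omega>\<bar> \<le> \<delta> * x" if "t \<in> {1..r}" for t using that by force
    have "\<bar>S \<omega>\<bar> \<le> (\<Sum>t=1..r. \<bar>X t \<omega>\<bar>)" unfolding S_def by (rule sum_abs)
    also have "\<dots> \<le> (\<Sum>t=1..r. \<delta> * x)" by (intro sum_mono small)
    also have "\<dots> = (r * \<delta>) * x" using r by simp
    also have "\<dots> \<le> \<epsilon> * x" using \<delta>(3) that by (intro mult_right_mono) auto
    finally have S_le: "\<bar>S \<omega>\<bar> \<le> \<epsilon> * x" .
    define Q where "Q = (\<Sum>t=1..r. (X t \<omega>)\<^sup>2)"
    have "min ((X t \<omega>)\<^sup>2) (x\<^sup>2) * w t \<omega> = (X t \<omega>)\<^sup>2 * ((S \<omega>)\<^sup>2 / Q)" if t: "t \<in> {1..r}" for t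
    proof (cases "X t \<omega> = 0")
      case False
      have "\<bar>X t \<omega>\<bar> \<le> 1 * x"
        using small[OF t] mult_right_mono[OF \<delta>(2), of x] \<open>0 < x\<close> by linarith
      then have "(X t \<omega>)\<^sup>2 \<le> x\<^sup>2" using power_mono[of "\<bar>X t \<omega>\<bar>" x 2] by simp
      moreover have "w t \<omega> = (S \<omega>)\<^sup>2 / Q"
        using cluster_ratio_normalised[of "1 - t" "r - t" "\<lambda>j. X (j + t) \<omega>"] t False
          sum_shift_int[of "\<lambda>j. X j \<omega>" t 1 r] sum_shift_int[of "\<lambda>j. (X j \<omega>)\<^sup>2" t 1 r]
        by (simp add: w_def S_def Q_def)
      ultimately show ?thesis by simp
    qed simp
    then have "A x \<omega> = (\<Sum>t=1..r. (X t \<omega>)\<^sup>2 * ((S \<omega>)\<^sup>2 / Q))"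
      unfolding A_def by (intro sum.cong) auto
    also have "\<dots> = Q * ((S \<omega>)\<^sup>2 / Q)" unfolding Q_def sum_distrib_right ..
    also have "\<dots> = (S \<omega>)\<^sup>2"
    proof (cases "Q = 0")
      case True
      then have "X t \<omega> = 0" if "t \<in> {1..r}" for t
        using that unfolding Q_def by (subst (asm) sum_nonneg_eq_0_iff) auto
      then have "S \<omega> = 0" unfolding S_def by (intro sum.neutral) auto
      then show ?thesis by simp
    qed simp
    finally have "A x \<omega> = (S \<omega>)\<^sup>2" .
    moreover have "0 \<le> K * x\<^sup>2 * (\<Sum>t=1..r. of_bool (\<delta> * x < \<bar>X t \<omega>\<bar>))"
      using r by (auto simp: K_def intro!: mult_nonneg_nonneg sum_nonneg)
    ultimately show ?thesis using S_le by simp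
  qed
  have bound: "\<bar>M.expectation (\<lambda>\<omega>. (S \<omega>)\<^sup>2 * of_bool (\<bar>S \<omega>\<bar> \<le> \<epsilon> * x)) / trunc x - M.expectation (A x) / trunc x\<bar>
      \<le> K * r * (x\<^sup>2 * tail (\<delta> * x) / trunc x)" if "0 < x" for x
  proof -
    have intA: "integrable M (A x)" unfolding A_def by (intro Bochner_Integration.integrable_sum int1)
    have intB: "integrable M (\<lambda>\<omega>. of_bool (\<delta> * x < \<bar>X t \<omega>\<bar>) :: real)" for t
      by (rule M.bounded_expectation[where B = 1]) auto
    have "\<bar>M.expectation (\<lambda>\<omega>. (S \<omega>)\<^sup>2 * of_bool (\<bar>S \<omega>\<bar> \<le> \<epsilon> * x)) - M.expectation (A x)\<bar>
        = \<bar>M.expectation (\<lambda>\<omega>. (S \<omega>)\<^sup>2 * of_bool (\<bar>S \<omega>\<bar> \<le> \<epsilon> * x) - A x \<omega>)\<bar>"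
      by (simp only: Bochner_Integration.integral_diff[OF int2 intA])
    also have "\<dots> \<le> M.expectation (\<lambda>\<omega>. K * x\<^sup>2 * (\<Sum>t=1..r. of_bool (\<delta> * x < \<bar>X t \<omega>\<bar>)))"
      by (rule order_trans[OF integral_abs_bound integral_mono])
        (intro integrable_abs Bochner_Integration.integrable_diff integrable_mult_right
          Bochner_Integration.integrable_sum int2 intA intB close that)+
    also have "\<dots> = K * x\<^sup>2 * (\<Sum>t=1..r. tail (\<delta> * x))"
      by (simp only: integral_mult_right_zero Bochner_Integration.integral_sum intB expectation_exceedance)
    also have "\<dots> = K * r * (x\<^sup>2 * tail (\<delta> * x))" using r by simp
    finally show ?thesis
      using trunc_pos[OF that] by (simp add: divide_right_mono abs_divide flip: diff_divide_distrib)
  qed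
  have "((\<lambda>x. M.expectation (\<lambda>\<omega>. (S \<omega>)\<^sup>2 * of_bool (\<bar>S \<omega>\<bar> \<le> \<epsilon> * x)) / trunc x
      - M.expectation (A x) / trunc x) \<longlongrightarrow> 0) at_top"
  proof (rule Lim_null_comparison)
    show "\<forall>\<^sub>F x in at_top. norm (M.expectation (\<lambda>\<omega>. (S \<omega>)\<^sup>2 * of_bool (\<bar>S \<omega>\<bar> \<le> \<epsilon> * x)) / trunc x
      - M.expectation (A x) / trunc x) \<le> K * r * (x\<^sup>2 * tail (\<delta> * x) / trunc x)"
      using eventually_gt_at_top[of 0] by eventually_elim (use bound in auto)
    show "((\<lambda>x. K * r * (x\<^sup>2 * tail (\<delta> * x) / trunc x)) \<longlongrightarrow> 0) at_top"
      using tendsto_mult[OF tendsto_const tail_negligible[OF \<delta>(1)], of "K * r"] by simp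
  qed
  from tendsto_add[OF this limA] show ?thesis by simp
qed

section \<open>Time change to the first nonzero index\<close>

text \<open>The time-change formula of spectral tail processes. The hypothesis says that \<open>f\<close> and \<open>g\<close> are the same
function of the path, homogeneous of degree 2, normalised by its value at 0 and by its value at \<open>s\<close>. Before
passing to the limit the two truncated expectations agree up to the event that \<open>X 0\<close> or \<open>X s\<close> exceeds the
truncation level, so they have the same limit.\<close>

lemma time_change:
  fixes s :: int
  assumes f: "window_continuous h f" "0 \<le> h" "\<And>v. \<bar>v 0\<bar> \<le> 1 \<Longrightarrow> \<bar>f v\<bar> \<le> C"
    and g: "window_continuous h g" "\<And>v. \<bar>v 0\<bar> \<le> 1 \<Longrightarrow> \<bar>g v\<bar> \<le> C"
    and eq: "\<And>v. (v 0)\<^sup>2 * f (\<lambda>j. v j / \<bar>v 0\<bar>) = (v s)\<^sup>2 * g (\<lambda>j. v (j + s) / \<bar>v s\<bar>)"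
  shows "N.expectation (\<lambda>\<omega>. f (\<lambda>j. \<Theta> j \<omega>)) = N.expectation (\<lambda>\<omega>. g (\<lambda>j. \<Theta> j \<omega>))"
proof -
  define F where "F x \<omega> = min ((X 0 \<omega>)\<^sup>2) (x\<^sup>2) * f (\<lambda>j. X (j + 0) \<omega> / \<bar>X 0 \<omega>\<bar>)" for x \<omega>
  define G where "G x \<omega> = min ((X s \<omega>)\<^sup>2) (x\<^sup>2) * g (\<lambda>j. X (j + s) \<omega> / \<bar>X s \<omega>\<bar>)" for x \<omega>
  have limF: "((\<lambda>x. M.expectation (F x) / trunc x) \<longlongrightarrow> N.expectation (\<lambda>\<omega>. f (\<lambda>j. \<Theta> j \<omega>))) at_top"
    unfolding F_def by (rule truncated_spectral_limit[OF f])
  have limG: "((\<lambda>x. M.expectation (G x) / trunc x) \<longlongrightarrow> N.expectation (\<lambda>\<omega>. g (\<lambda>j. \<Theta> j \<omega>))) at_top"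
    unfolding G_def by (rule truncated_spectral_limit[OF g(1) f(2) g(2)])
  have C0: "0 \<le> C" using f(3)[of "\<lambda>_. 0"] by simp
  have F_le: "\<bar>F x \<omega>\<bar> \<le> C * x\<^sup>2" for x \<omega>
  proof -
    have "\<bar>f (\<lambda>j. X (j + 0) \<omega> / \<bar>X 0 \<omega>\<bar>)\<bar> \<le> C" by (rule f(3)) auto
    then have "\<bar>F x \<omega>\<bar> \<le> x\<^sup>2 * C" using C0 unfolding F_def by (auto simp: abs_mult intro!: mult_mono)
    then show ?thesis by (simp add: mult.commute)
  qed
  have G_le: "\<bar>G x \<omega>\<bar> \<le> C * x\<^sup>2" for x \<omega>
  proof -
    have "\<bar>g (\<lambda>j. X (j + s) \<omega> / \<bar>X s \<omega>\<bar>)\<bar> \<le> C" by (rule g(2)) auto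
    then have "\<bar>G x \<omega>\<bar> \<le> x\<^sup>2 * C" using C0 unfolding G_def by (auto simp: abs_mult intro!: mult_mono)
    then show ?thesis by (simp add: mult.commute)
  qed
  have [measurable]: "F x \<in> borel_measurable M" "G x \<in> borel_measurable M" for x
    unfolding F_def G_def
    by (intro borel_measurable_times borel_measurable_paths[OF _ window_functional_measurable[OF f(1)]]
          borel_measurable_paths[OF _ window_functional_measurable[OF g(1)]]; measurable)+
  have intF: "integrable M (F x)" and intG: "integrable M (G x)" for x
    by (rule M.bounded_expectation[OF _ F_le]; simp) (rule M.bounded_expectation[OF _ G_le]; simp)
  have close: "\<bar>F x \<omega> - G x \<omega>\<bar> \<le> 2 * C * x\<^sup>2 * (of_bool (x < \<bar>X 0 \<omega>\<bar>) + of_bool (x < \<bar>X s \<omega>\<bar>))" for x \<omega>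
  proof (cases "x < \<bar>X 0 \<omega>\<bar> \<or> x < \<bar>X s \<omega>\<bar>")
    case True
    have "\<bar>F x \<omega> - G x \<omega>\<bar> \<le> 2 * C * x\<^sup>2 * 1" using F_le[of x \<omega>] G_le[of x \<omega>] by linarith
    also have "\<dots> \<le> 2 * C * x\<^sup>2 * (of_bool (x < \<bar>X 0 \<omega>\<bar>) + of_bool (x < \<bar>X s \<omega>\<bar>))"
      using True C0 by (intro mult_left_mono) auto
    finally show ?thesis .
  next
    case False
    then have "(X 0 \<omega>)\<^sup>2 \<le> x\<^sup>2" "(X s \<omega>)\<^sup>2 \<le> x\<^sup>2"
      using power_mono[of "\<bar>X 0 \<omega>\<bar>" x 2] power_mono[of "\<bar>X s \<omega>\<bar>" x 2] by auto
    then have "F x \<omega> = G x \<omega>" using eq[of "\<lambda>j. X j \<omega>"] by (simp add: F_def G_def)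
    then show ?thesis using C0 by simp
  qed
  have bound: "\<bar>M.expectation (F x) / trunc x - M.expectation (G x) / trunc x\<bar>
      \<le> 4 * C * (x\<^sup>2 * tail (1 * x) / trunc x)" if "0 < x" for x
  proof -
    have intB: "integrable M (\<lambda>\<omega>. of_bool (x < \<bar>X t \<omega>\<bar>) :: real)" for t
      by (rule M.bounded_expectation[where B = 1]) auto
    have "\<bar>M.expectation (F x) - M.expectation (G x)\<bar> = \<bar>M.expectation (\<lambda>\<omega>. F x \<omega> - G x \<omega>)\<bar>"
      by (simp only: Bochner_Integration.integral_diff[OF intF intG])
    also have "\<dots> \<le> M.expectation (\<lambda>\<omega>. 2 * C * x\<^sup>2 * (of_bool (x < \<bar>X 0 \<omega>\<bar>) + of_bool (x < \<bar>X s \<omega>\<bar>)))"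
      by (rule order_trans[OF integral_abs_bound integral_mono])
        (intro integrable_abs Bochner_Integration.integrable_diff integrable_mult_right
          Bochner_Integration.integrable_add intF intG intB close)+
    also have "\<dots> = 2 * C * x\<^sup>2 * (tail x + tail x)"
      by (simp only: integral_mult_right_zero Bochner_Integration.integral_add intB expectation_exceedance)
    also have "\<dots> = 4 * C * (x\<^sup>2 * tail (1 * x))" by simp
    finally show ?thesis
      using trunc_pos[OF that] by (simp add: divide_right_mono abs_divide flip: diff_divide_distrib)
  qed
  have "((\<lambda>x. M.expectation (F x) / trunc x - M.expectation (G x) / trunc x) \<longlongrightarrow> 0) at_top"
  proof (rule Lim_null_comparison)
    show "\<forall>\<^sub>F x in at_top. norm (M.expectation (F x) / trunc x - M.expectation (G x) / trunc x)
        \<le> 4 * C * (x\<^sup>2 * tail (1 * x) / trunc x)"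
      using eventually_gt_at_top[of 0] by eventually_elim (use bound in auto)
    show "((\<lambda>x. 4 * C * (x\<^sup>2 * tail (1 * x) / trunc x)) \<longlongrightarrow> 0) at_top"
      using tendsto_mult[OF tendsto_const tail_negligible[of 1], of "4 * C"] by simp
  qed
  moreover have "((\<lambda>x. M.expectation (F x) / trunc x - M.expectation (G x) / trunc x) \<longlongrightarrow>
      N.expectation (\<lambda>\<omega>. f (\<lambda>j. \<Theta> j \<omega>)) - N.expectation (\<lambda>\<omega>. g (\<lambda>j. \<Theta> j \<omega>))) at_top"
    by (rule tendsto_diff[OF limF limG])
  ultimately show ?thesis using tendsto_unique[OF trivial_limit_at_top_linorder] by fastforce
qed

end

lemma tendsto_max_diff_indicator:
  fixes a b :: real
  assumes "0 \<le> a" "0 \<le> b"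
  shows "(\<lambda>k. max 0 (a - real k * b)) \<longlonglongrightarrow> a * of_bool (b = 0)"
proof (cases "b = 0")
  case True
  then show ?thesis using assms by simp
next
  case False
  have "\<forall>\<^sub>F k in sequentially. max 0 (a - real k * b) = 0"
    using eventually_ge_at_top[of "nat \<lceil>a / b\<rceil>"]
  proof eventually_elim
    case (elim k)
    then have "a / b \<le> real k" by linarith
    then show ?case using assms False by (simp add: field_simps)
  qed
  then show ?thesis using False by (simp add: tendsto_eventually)
qed

lemma tendsto_min_scaled_indicator:
  fixes c d :: real
  assumes "0 \<le> c" "0 \<le> d"
  shows "(\<lambda>k. min (real k * c) d) \<longlonglongrightarrow> d * of_bool (c \<noteq> 0)"
proof (cases "c = 0")
  case True
  then show ?thesis using assms by simp
next
  case False
  have "\<forall>\<^sub>F k in sequentially. min (real k * c) d = d"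
    using eventually_ge_at_top[of "nat \<lceil>d / c\<rceil>"]
  proof eventually_elim
    case (elim k)
    then have "d / c \<le> real k" by linarith
    then show ?case using assms False by (simp add: field_simps)
  qed
  then show ?thesis using False by (simp add: tendsto_eventually)
qed

text \<open>As \<open>k\<close> grows, \<open>quiet_past m k v\<close> tends to \<open>|v 0|\<close> times the indicator that \<open>v\<close> vanishes at the \<open>m\<close>
times before 0. This is a continuous substitute, homogeneous of degree 1, for an indicator to which weak convergence does not
apply.\<close>

definition quiet_past :: "nat \<Rightarrow> nat \<Rightarrow> (int \<Rightarrow> real) \<Rightarrow> real" where
  "quiet_past m k v = max 0 (\<bar>v 0\<bar> - real k * (\<Sum>i=1..m. \<bar>v (- int i)\<bar>))"

lemma quiet_past_bounds: "0 \<le> quiet_past m k v" "quiet_past m k v \<le> \<bar>v 0\<bar>"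
  by (auto simp: quiet_past_def sum_nonneg)

lemma quiet_past_scale: "quiet_past m k (\<lambda>j. v j / \<bar>c\<bar>) = quiet_past m k v / \<bar>c\<bar>"
proof -
  have "\<bar>v 0 / \<bar>c\<bar>\<bar> - real k * (\<Sum>i=1..m. \<bar>v (- int i) / \<bar>c\<bar>\<bar>) =
      (\<bar>v 0\<bar> - real k * (\<Sum>i=1..m. \<bar>v (- int i)\<bar>)) / \<bar>c\<bar>"
    by (simp add: diff_divide_distrib flip: sum_divide_distrib)
  moreover have "max 0 (y / \<bar>c\<bar>) = max 0 y / \<bar>c\<bar>" for y
    by (cases "c = 0") (auto simp: max_def field_simps)
  ultimately show ?thesis unfolding quiet_past_def by simp
qed

lemma quiet_past_tendsto:
  "(\<lambda>k. quiet_past m k v) \<longlonglongrightarrow> \<bar>v 0\<bar> * of_bool (\<forall>i\<in>{1..m}. v (- int i) = 0)"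
proof -
  have "(\<Sum>i=1..m. \<bar>v (- int i)\<bar>) = 0 \<longleftrightarrow> (\<forall>i\<in>{1..m}. v (- int i) = 0)"
    by (simp add: sum_nonneg_eq_0_iff)
  then show ?thesis
    unfolding quiet_past_def
    using tendsto_max_diff_indicator[of "\<bar>v 0\<bar>" "\<Sum>i=1..m. \<bar>v (- int i)\<bar>"]
    by (simp add: sum_nonneg)
qed

lemma continuous_quiet_past: "continuous_on UNIV (quiet_past m k)"
proof -
  have "continuous_on UNIV (\<lambda>v. max 0 (\<bar>v 0\<bar> - real k * (\<Sum>i=1..m. \<bar>v (- int i)\<bar>)))"
    by (intro continuous_intros continuous_on_product_coordinates)
  then show ?thesis by (simp add: quiet_past_def[abs_def])
qed

lemma quiet_past_cong:
  assumes "\<And>j. j \<in> {- int m..0} \<Longrightarrow> v j = w j"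
  shows "quiet_past m k v = quiet_past m k w"
proof -
  have "v 0 = w 0" using assms by simp
  moreover have "(\<Sum>i=1..m. \<bar>v (- int i)\<bar>) = (\<Sum>i=1..m. \<bar>w (- int i)\<bar>)"
    using assms by (intro sum.cong) auto
  ultimately show ?thesis unfolding quiet_past_def by simp
qed

lemma quiet_past_measurable [measurable]:
  assumes [measurable]: "\<And>j. V j \<in> borel_measurable M"
  shows "(\<lambda>\<omega>. quiet_past m k (\<lambda>j. V j \<omega>)) \<in> borel_measurable M"
  unfolding quiet_past_def by measurable

text \<open>The first nonzero index of a path that vanishes before \<open>- m\<close> is written \<open>- s\<close>, so that \<open>s\<close> is the shift
in the time-change formula.\<close>

definition cluster_starts :: "nat \<Rightarrow> (int \<Rightarrow> real) \<Rightarrow> int \<Rightarrow> bool" where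
  "cluster_starts m v s \<longleftrightarrow> v (- s) \<noteq> 0 \<and> (\<forall>i\<in>{1..m}. v (- s - int i) = 0)"

text \<open>A path that is nonzero at 0 and vanishes before \<open>- m\<close> has exactly one first nonzero index, namely
\<open>- t\<close> for the largest \<open>t \<le> m\<close> with \<open>v (- t) \<noteq> 0\<close>.\<close>

lemma sum_cluster_starts:
  assumes v0: "v 0 \<noteq> 0" and zero: "\<And>j. j < - int m \<Longrightarrow> v j = 0"
  shows "(\<Sum>s=0..int m. of_bool (cluster_starts m v s) :: real) = 1"
proof -
  define A where "A = {s \<in> {0..int m}. v (- s) \<noteq> 0}"
  define t where "t = Max A"
  have A: "finite A" "0 \<in> A"
    using v0 by (auto simp: A_def intro: finite_subset[of _ "{0..int m}"])
  then have "t \<in> A" unfolding t_def by (intro Max_in) auto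
  have max: "s \<le> t" if "s \<in> A" for s unfolding t_def using A that by simp
  have "cluster_starts m v s \<longleftrightarrow> s = t" if s: "s \<in> {0..int m}" for s
  proof
    assume L: "cluster_starts m v s"
    then have "s \<le> t" using max s by (auto simp: A_def cluster_starts_def)
    moreover have False if "s < t"
    proof -
      have "nat (t - s) \<in> {1..m}" using that s \<open>t \<in> A\<close> by (auto simp: A_def)
      with L have "v (- s - int (nat (t - s))) = 0" unfolding cluster_starts_def by blast
      then show False using that \<open>t \<in> A\<close> by (simp add: A_def)
    qed
    ultimately show "s = t" by force
  next
    assume "s = t"
    have "v (- t - int i) = 0" if "i \<in> {1..m}" for i
    proof (rule ccontr)
      assume nz: "v (- t - int i) \<noteq> 0"
      then have "t + int i \<le> int m" using zero[of "- t - int i"] by linarith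
      then have "t + int i \<in> A" using nz \<open>t \<in> A\<close> by (auto simp: A_def algebra_simps)
      then show False using max[of "t + int i"] that by auto
    qed
    then show "cluster_starts m v s"
      using \<open>t \<in> A\<close> \<open>s = t\<close> by (auto simp: cluster_starts_def A_def)
  qed
  then have "(\<Sum>s=0..int m. of_bool (cluster_starts m v s) :: real) = (\<Sum>s=0..int m. of_bool (s = t))"
    by (intro sum.cong) auto
  also have "\<dots> = 1" using \<open>t \<in> A\<close> by (simp add: A_def of_bool_def)
  finally show ?thesis .
qed

context heavy_tailed_sequence
begin

text \<open>The time change for the functional that equals the cluster ratio times \<open>min (K * (quiet_past m k v)\<^sup>2) ((v s)\<^sup>2)\<close>. The
minimum makes it bounded by a multiple of \<open>(v 0)\<^sup>2\<close> and of \<open>(v s)\<^sup>2\<close> at once, as both normalisations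
demand.\<close>

lemma time_change_truncated:
  fixes a b s :: int
  assumes ab: "a \<le> 0" "0 \<le> b" "a \<le> s" "s \<le> b"
  shows "N.expectation (\<lambda>\<omega>. cluster_ratio a b (\<lambda>j. \<Theta> j \<omega>) *
            min (real K * (quiet_past m k (\<lambda>j. \<Theta> j \<omega>))\<^sup>2) ((\<Theta> s \<omega>)\<^sup>2)) =
         N.expectation (\<lambda>\<omega>. cluster_ratio (a - s) (b - s) (\<lambda>j. \<Theta> j \<omega>) *
            min (real K * (quiet_past m k (\<lambda>j. \<Theta> (j - s) \<omega>))\<^sup>2) ((\<Theta> 0 \<omega>)\<^sup>2))"
proof (rule time_change[where h = "\<bar>a\<bar> + \<bar>b\<bar> + \<bar>s\<bar> + int m" and s = s
      and C = "(real K + 1) * real (card {a..b})"])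
  let ?h = "\<bar>a\<bar> + \<bar>b\<bar> + \<bar>s\<bar> + int m"
  let ?f = "\<lambda>v. cluster_ratio a b v * min (real K * (quiet_past m k v)\<^sup>2) ((v s)\<^sup>2)"
  let ?g = "\<lambda>v. cluster_ratio (a - s) (b - s) v * min (real K * (quiet_past m k (\<lambda>j. v (j - s)))\<^sup>2) ((v 0)\<^sup>2)"
  show "window_continuous ?h ?f"
    unfolding window_continuous_def
  proof safe
    show "continuous_on UNIV ?f"
      by (intro continuous_intros continuous_cluster_ratio continuous_quiet_past continuous_on_product_coordinates)
    fix v w :: "int \<Rightarrow> real" assume "\<forall>j\<in>{- ?h..?h}. v j = w j"
    then have eq: "v j = w j" if "\<bar>j\<bar> \<le> ?h" for j using that by (simp add: abs_le_iff)
    have "cluster_ratio a b v = cluster_ratio a b w" by (rule cluster_ratio_cong, rule eq) (simp only: atLeastAtMost_iff, linarith)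
    moreover have "quiet_past m k v = quiet_past m k w" by (rule quiet_past_cong, rule eq) (simp only: atLeastAtMost_iff, linarith)
    moreover have "v s = w s" by (rule eq) linarith
    ultimately show "?f v = ?f w" by simp
  qed
  show "window_continuous ?h ?g"
    unfolding window_continuous_def
  proof safe
    have "continuous_on UNIV (\<lambda>v (j::int). v (j - s) :: real)"
      by (intro continuous_on_coordinatewise_then_product continuous_on_product_coordinates)
    then have "continuous_on UNIV (\<lambda>v. quiet_past m k (\<lambda>j. v (j - s)))"
      by (intro continuous_on_compose2[OF continuous_quiet_past]) auto
    then show "continuous_on UNIV ?g"
      by (intro continuous_intros continuous_cluster_ratio continuous_on_product_coordinates)
    fix v w :: "int \<Rightarrow> real" assume "\<forall>j\<in>{- ?h..?h}. v j = w j"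
    then have eq: "v j = w j" if "\<bar>j\<bar> \<le> ?h" for j using that by (simp add: abs_le_iff)
    have "cluster_ratio (a - s) (b - s) v = cluster_ratio (a - s) (b - s) w"
      by (rule cluster_ratio_cong, rule eq) (simp only: atLeastAtMost_iff, linarith)
    moreover have "quiet_past m k (\<lambda>j. v (j - s)) = quiet_past m k (\<lambda>j. w (j - s))"
      by (rule quiet_past_cong, rule eq) (simp only: atLeastAtMost_iff, linarith)
    moreover have "v 0 = w 0" by (rule eq) simp
    ultimately show "?g v = ?g w" by simp
  qed
  show "\<bar>?f v\<bar> \<le> (real K + 1) * real (card {a..b})" if "\<bar>v 0\<bar> \<le> 1" for v
  proof -
    have "(quiet_past m k v)\<^sup>2 \<le> 1\<^sup>2"
      using quiet_past_bounds[of m k v] that by (intro power_mono) auto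
    then have "min (real K * (quiet_past m k v)\<^sup>2) ((v s)\<^sup>2) \<le> real K + 1"
      using mult_left_mono[of "(quiet_past m k v)\<^sup>2" 1 "real K"] by auto
    then have "?f v \<le> real (card {a..b}) * (real K + 1)"
      using cluster_ratio_le by (intro mult_mono) auto
    then show ?thesis by (simp add: mult.commute)
  qed
  show "\<bar>?g v\<bar> \<le> (real K + 1) * real (card {a..b})" if "\<bar>v 0\<bar> \<le> 1" for v
  proof -
    have "(v 0)\<^sup>2 \<le> 1\<^sup>2" using that power_mono[of "\<bar>v 0\<bar>" 1 2] by simp
    then have "min (real K * (quiet_past m k (\<lambda>j. v (j - s)))\<^sup>2) ((v 0)\<^sup>2) \<le> real K + 1" by auto
    then have "?g v \<le> real (card {a - s..b - s}) * (real K + 1)"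
      using cluster_ratio_le[of "a - s" "b - s" v] by (intro mult_mono) auto
    then show ?thesis by (simp add: mult.commute)
  qed
  show "(v 0)\<^sup>2 * ?f (\<lambda>j. v j / \<bar>v 0\<bar>) =
      (v s)\<^sup>2 * (cluster_ratio (a - s) (b - s) (\<lambda>j. v (j + s) / \<bar>v s\<bar>) *
        min (real K * (quiet_past m k (\<lambda>j. v (j - s + s) / \<bar>v s\<bar>))\<^sup>2) ((v (0 + s) / \<bar>v s\<bar>)\<^sup>2))" for v
  proof (cases "v 0 = 0 \<or> v s = 0")
    case True
    have "quiet_past m k v = 0" if "v 0 = 0"
      using quiet_past_bounds[of m k v] that by simp
    with True show ?thesis by (auto simp: quiet_past_scale)
  next
    case False
    have *: "c\<^sup>2 * min (real K * (y / \<bar>c\<bar>)\<^sup>2) ((z / \<bar>c\<bar>)\<^sup>2) = min (real K * y\<^sup>2) (z\<^sup>2)" if "c \<noteq> 0" for c y z :: real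
      using that by (simp add: min_mult_distrib_left power_divide)
    have "cluster_ratio a b (\<lambda>j. v j / \<bar>v 0\<bar>) = cluster_ratio (a - s) (b - s) (\<lambda>j. v (j + s) / \<bar>v s\<bar>)"
      using cluster_ratio_normalised[of a b v] cluster_ratio_normalised[of "a - s" "b - s" "\<lambda>j. v (j + s)"]
        False ab sum_shift_int[of v s a b] sum_shift_int[of "\<lambda>j. (v j)\<^sup>2" s a b] by simp
    moreover have "(v 0)\<^sup>2 * min (real K * (quiet_past m k (\<lambda>j. v j / \<bar>v 0\<bar>))\<^sup>2) ((v s / \<bar>v 0\<bar>)\<^sup>2) =
        (v s)\<^sup>2 * min (real K * (quiet_past m k (\<lambda>j. v j / \<bar>v s\<bar>))\<^sup>2) ((v s / \<bar>v s\<bar>)\<^sup>2)"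
      using False by (simp only: quiet_past_scale * de_Morgan_disj not_False_eq_True)
    ultimately show ?thesis by (simp add: mult.left_commute)
  qed
qed auto

text \<open>First \<open>k\<close> and then \<open>K\<close> tends to infinity in \<open>time_change_truncated\<close>. The first limit is dominated on both
sides, the second only on the right; on the left it is monotone, and this also yields
integrability of a quantity that involves the unbounded \<open>(\<Theta> s)\<^sup>2\<close>.\<close>

lemma time_change_first_index:
  fixes a b s :: int
  assumes ab: "a \<le> 0" "0 \<le> b" "a \<le> s" "s \<le> b"
  shows "integrable N (\<lambda>\<omega>. cluster_ratio a b (\<lambda>j. \<Theta> j \<omega>) *
            ((\<Theta> s \<omega>)\<^sup>2 * of_bool (\<forall>i\<in>{1..m}. \<Theta> (- int i) \<omega> = 0)))" (is "integrable N ?u")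
    and "N.expectation (\<lambda>\<omega>. cluster_ratio a b (\<lambda>j. \<Theta> j \<omega>) *
            ((\<Theta> s \<omega>)\<^sup>2 * of_bool (\<forall>i\<in>{1..m}. \<Theta> (- int i) \<omega> = 0))) =
         N.expectation (\<lambda>\<omega>. cluster_ratio (a - s) (b - s) (\<lambda>j. \<Theta> j \<omega>) *
            of_bool (cluster_starts m (\<lambda>j. \<Theta> j \<omega>) s))"
proof -
  let ?c = "\<lambda>\<omega>. cluster_ratio a b (\<lambda>j. \<Theta> j \<omega>)" and ?d = "\<lambda>\<omega>. cluster_ratio (a - s) (b - s) (\<lambda>j. \<Theta> j \<omega>)"
  let ?P = "\<lambda>\<omega>. \<forall>i\<in>{1..m}. \<Theta> (- int i) \<omega> = 0" and ?R = "\<lambda>\<omega>. \<forall>i\<in>{1..m}. \<Theta> (- int i - s) \<omega> = 0"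
  let ?n = "real (card {a..b})"
  have d_le: "?d \<omega> \<le> ?n" for \<omega> using cluster_ratio_le[of "a - s" "b - s"] by simp
  define U where "U K \<omega> = ?c \<omega> * min (real K * (\<bar>\<Theta> 0 \<omega>\<bar> * of_bool (?P \<omega>))\<^sup>2) ((\<Theta> s \<omega>)\<^sup>2)" for K \<omega>
  define V where "V K \<omega> = ?d \<omega> * min (real K * (\<bar>\<Theta> (- s) \<omega>\<bar> * of_bool (?R \<omega>))\<^sup>2) ((\<Theta> 0 \<omega>)\<^sup>2)" for K \<omega>
  have [measurable]: "U K \<in> borel_measurable N" "V K \<in> borel_measurable N" for K
    unfolding U_def V_def by measurable
  have UV: "N.expectation (U K) = N.expectation (V K)" for K
  proof -
    have "(\<lambda>k. N.expectation (\<lambda>\<omega>. ?c \<omega> * min (real K * (quiet_past m k (\<lambda>j. \<Theta> j \<omega>))\<^sup>2) ((\<Theta> s \<omega>)\<^sup>2)))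
        \<longlonglongrightarrow> N.expectation (U K)"
    proof (rule integral_dominated_convergence[where w = "\<lambda>_. ?n * real K"])
      show "AE \<omega> in N. (\<lambda>k. ?c \<omega> * min (real K * (quiet_past m k (\<lambda>j. \<Theta> j \<omega>))\<^sup>2) ((\<Theta> s \<omega>)\<^sup>2)) \<longlonglongrightarrow> U K \<omega>"
        unfolding U_def by (intro AE_I2 tendsto_intros quiet_past_tendsto)
      show "AE \<omega> in N. norm (?c \<omega> * min (real K * (quiet_past m k (\<lambda>j. \<Theta> j \<omega>))\<^sup>2) ((\<Theta> s \<omega>)\<^sup>2)) \<le> ?n * real K" for k
        using abs_\<Theta>_0
      proof eventually_elim
        case (elim \<omega>)
        have "(quiet_past m k (\<lambda>j. \<Theta> j \<omega>))\<^sup>2 \<le> 1\<^sup>2"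
          using quiet_past_bounds[of m k "\<lambda>j. \<Theta> j \<omega>"] elim by (intro power_mono) auto
        then have "min (real K * (quiet_past m k (\<lambda>j. \<Theta> j \<omega>))\<^sup>2) ((\<Theta> s \<omega>)\<^sup>2) \<le> real K"
          using mult_left_mono[of "(quiet_past m k (\<lambda>j. \<Theta> j \<omega>))\<^sup>2" 1 "real K"] by auto
        then have "?c \<omega> * min (real K * (quiet_past m k (\<lambda>j. \<Theta> j \<omega>))\<^sup>2) ((\<Theta> s \<omega>)\<^sup>2) \<le> ?n * real K"
          using cluster_ratio_le by (intro mult_mono) auto
        then show ?case by simp
      qed
    qed auto
    moreover have "(\<lambda>k. N.expectation (\<lambda>\<omega>. ?d \<omega> * min (real K * (quiet_past m k (\<lambda>j. \<Theta> (j - s) \<omega>))\<^sup>2) ((\<Theta> 0 \<omega>)\<^sup>2)))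
        \<longlonglongrightarrow> N.expectation (V K)"
    proof (rule integral_dominated_convergence[where w = "\<lambda>_. ?n * 1"])
      show "AE \<omega> in N. (\<lambda>k. ?d \<omega> * min (real K * (quiet_past m k (\<lambda>j. \<Theta> (j - s) \<omega>))\<^sup>2) ((\<Theta> 0 \<omega>)\<^sup>2)) \<longlonglongrightarrow> V K \<omega>"
      proof (rule AE_I2)
        fix \<omega>
        have "(\<lambda>k. quiet_past m k (\<lambda>j. \<Theta> (j - s) \<omega>)) \<longlonglongrightarrow> \<bar>\<Theta> (- s) \<omega>\<bar> * of_bool (?R \<omega>)"
          using quiet_past_tendsto[of m "\<lambda>j. \<Theta> (j - s) \<omega>"] by simp
        then show "(\<lambda>k. ?d \<omega> * min (real K * (quiet_past m k (\<lambda>j. \<Theta> (j - s) \<omega>))\<^sup>2) ((\<Theta> 0 \<omega>)\<^sup>2)) \<longlonglongrightarrow> V K \<omega>"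
          unfolding V_def by (intro tendsto_intros)
      qed
      show "AE \<omega> in N. norm (?d \<omega> * min (real K * (quiet_past m k (\<lambda>j. \<Theta> (j - s) \<omega>))\<^sup>2) ((\<Theta> 0 \<omega>)\<^sup>2)) \<le> ?n * 1" for k
        using abs_\<Theta>_0
      proof eventually_elim
        case (elim \<omega>)
        then have "(\<Theta> 0 \<omega>)\<^sup>2 = 1" by (metis one_power2 power2_abs)
        then have "?d \<omega> * min (real K * (quiet_past m k (\<lambda>j. \<Theta> (j - s) \<omega>))\<^sup>2) ((\<Theta> 0 \<omega>)\<^sup>2) \<le> ?n * 1"
          using d_le by (intro mult_mono) auto
        then show ?case by simp
      qed
    qed auto
    ultimately show ?thesis
      unfolding time_change_truncated[OF ab] by (rule LIMSEQ_unique)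
  qed
  have limV: "(\<lambda>K. N.expectation (V K)) \<longlonglongrightarrow>
      N.expectation (\<lambda>\<omega>. ?d \<omega> * of_bool (cluster_starts m (\<lambda>j. \<Theta> j \<omega>) s))"
  proof (rule integral_dominated_convergence[where w = "\<lambda>_. ?n * 1"])
    show "(\<lambda>\<omega>. ?d \<omega> * of_bool (cluster_starts m (\<lambda>j. \<Theta> j \<omega>) s)) \<in> borel_measurable N"
      unfolding cluster_starts_def by measurable
    show "AE \<omega> in N. (\<lambda>K. V K \<omega>) \<longlonglongrightarrow> ?d \<omega> * of_bool (cluster_starts m (\<lambda>j. \<Theta> j \<omega>) s)"
      using abs_\<Theta>_0
    proof eventually_elim
      case (elim \<omega>)
      then have 1: "(\<Theta> 0 \<omega>)\<^sup>2 = 1" by (metis one_power2 power2_abs)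
      have "(\<lambda>K. V K \<omega>) \<longlonglongrightarrow> ?d \<omega> * ((\<Theta> 0 \<omega>)\<^sup>2 * of_bool ((\<bar>\<Theta> (- s) \<omega>\<bar> * of_bool (?R \<omega>))\<^sup>2 \<noteq> 0))"
        unfolding V_def by (intro tendsto_intros tendsto_min_scaled_indicator) auto
      moreover have "(\<bar>\<Theta> (- s) \<omega>\<bar> * of_bool (?R \<omega>))\<^sup>2 \<noteq> 0 \<longleftrightarrow> cluster_starts m (\<lambda>j. \<Theta> j \<omega>) s"
      proof -
        have comm: "- int i - s = - s - int i" for i by simp
        show ?thesis unfolding cluster_starts_def comm by simp
      qed
      ultimately show ?case by (simp only: 1 mult_1)
    qed
    show "AE \<omega> in N. norm (V K \<omega>) \<le> ?n * 1" for K
      using abs_\<Theta>_0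
    proof eventually_elim
      case (elim \<omega>)
      then have "(\<Theta> 0 \<omega>)\<^sup>2 = 1" by (metis one_power2 power2_abs)
      then have "V K \<omega> \<le> ?n * 1"
        unfolding V_def using d_le by (intro mult_mono) auto
      moreover have "0 \<le> V K \<omega>" unfolding V_def by simp
      ultimately show ?case by simp
    qed
  qed auto
  have intU: "integrable N (U K)" for K
  proof (rule N.integrable_const_bound[where B = "?n * real K"])
    show "AE \<omega> in N. norm (U K \<omega>) \<le> ?n * real K"
      using abs_\<Theta>_0
    proof eventually_elim
      case (elim \<omega>)
      have "U K \<omega> \<le> ?n * real K"
        unfolding U_def elim using cluster_ratio_le by (intro mult_mono) (auto simp: min_def)
      moreover have "0 \<le> U K \<omega>" unfolding U_def by simp
      ultimately show ?case by simp
    qed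
  qed simp
  have mono: "AE \<omega> in N. mono (\<lambda>K. U K \<omega>)"
    unfolding U_def by (intro AE_I2 monoI mult_left_mono min.mono mult_right_mono) auto
  have limU: "AE \<omega> in N. (\<lambda>K. U K \<omega>) \<longlonglongrightarrow> ?u \<omega>"
    using abs_\<Theta>_0
  proof eventually_elim
    case (elim \<omega>)
    have "(\<lambda>K. U K \<omega>) \<longlonglongrightarrow> ?c \<omega> * ((\<Theta> s \<omega>)\<^sup>2 * of_bool ((\<bar>\<Theta> 0 \<omega>\<bar> * of_bool (?P \<omega>))\<^sup>2 \<noteq> 0))"
      unfolding U_def by (intro tendsto_intros tendsto_min_scaled_indicator) auto
    then show ?case by (simp add: elim)
  qed
  note conv = intU mono limU limV[folded UV]
  show "integrable N ?u" by (rule integrable_monotone_convergence[OF conv]) measurable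
  show "N.expectation ?u = N.expectation (\<lambda>\<omega>. ?d \<omega> * of_bool (cluster_starts m (\<lambda>j. \<Theta> j \<omega>) s))"
    by (rule integral_monotone_convergence[OF conv]) measurable
qed

end

section \<open>Consequences of m-dependence\<close>

lemma (in prob_space) m_dependent_indep:
  assumes "m_dependent m M X" and "s + int m < t"
  shows "indep_var borel (X s) borel (X t)"
proof -
  have "indep_var (Pi\<^sub>M {..s} (\<lambda>_. borel)) (\<lambda>\<omega>. \<lambda>u\<in>{..s}. X u \<omega>)
        (Pi\<^sub>M {s + int m<..} (\<lambda>_. borel)) (\<lambda>\<omega>. \<lambda>u\<in>{s + int m<..}. X u \<omega>)"
    using assms(1) by (simp add: m_dependent_def)
  then have "indep_var borel ((\<lambda>v. v s) \<circ> (\<lambda>\<omega>. \<lambda>u\<in>{..s}. X u \<omega>))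
      borel ((\<lambda>v. v t) \<circ> (\<lambda>\<omega>. \<lambda>u\<in>{s + int m<..}. X u \<omega>))"
    using assms(2) by (intro indep_var_compose) auto
  then show ?thesis using assms(2) by (simp add: comp_def)
qed

lemma (in prob_space) indep_var_bounded_product:
  fixes g k :: "real \<Rightarrow> real"
  assumes ind: "indep_var borel V borel W"
    and [measurable]: "g \<in> borel_measurable borel" "k \<in> borel_measurable borel"
    and B: "\<And>y. \<bar>g y\<bar> \<le> 1" "\<And>y. \<bar>k y\<bar> \<le> 1"
  shows "expectation (\<lambda>\<omega>. g (V \<omega>) * k (W \<omega>)) = expectation (\<lambda>\<omega>. g (V \<omega>)) * expectation (\<lambda>\<omega>. k (W \<omega>))"
proof -
  have [measurable]: "random_variable borel V" "random_variable borel W"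
    using ind by (auto dest: indep_var_rv1 indep_var_rv2)
  have "indep_var borel (g \<circ> V) borel (k \<circ> W)"
    by (rule indep_var_compose[OF ind]) auto
  from indep_var_lebesgue_integral[OF this] show ?thesis
    using B by (simp add: comp_def bounded_expectation(1)[where B = 1])
qed

locale m_dependent_heavy_tailed_sequence = heavy_tailed_sequence +
  fixes m :: nat
  assumes m_dependent: "m_dependent m M X"
begin

lemma exceedance_product:
  assumes "int m < \<bar>t\<bar>" and [measurable]: "g \<in> borel_measurable borel" and B: "\<And>y. \<bar>g y\<bar> \<le> 1"
  shows "M.expectation (\<lambda>\<omega>. g (X t \<omega>) * of_bool (x < \<bar>X 0 \<omega>\<bar>)) = M.expectation (\<lambda>\<omega>. g (X t \<omega>)) * tail x"
proof (cases "t < 0")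
  case True
  then have "t + int m < 0" using assms(1) by linarith
  from M.indep_var_bounded_product[OF M.m_dependent_indep[OF m_dependent this],
      of g "\<lambda>y. of_bool (x < \<bar>y\<bar>)"]
  show ?thesis using B by (simp add: tail_def)
next
  case False
  then have "0 + int m < t" using assms(1) by linarith
  from M.indep_var_bounded_product[OF M.m_dependent_indep[OF m_dependent this],
      of "\<lambda>y. of_bool (x < \<bar>y\<bar>)" g]
  show ?thesis using B by (simp add: tail_def mult.commute)
qed

text \<open>For \<open>|t| > m\<close> the variable \<open>X t\<close> is independent of the event \<open>x < |X 0|\<close>, hence negligible compared with
\<open>x\<close> on that event.\<close>

lemma spectral_vanishes:
  assumes t: "int m < \<bar>t\<bar>"
  shows "AE \<omega> in N. \<Theta> t \<omega> = 0"
proof -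
  let ?f = "\<lambda>v :: int \<Rightarrow> real. min 1 \<bar>v t\<bar>"
  have wc: "window_continuous \<bar>t\<bar> ?f"
    unfolding window_continuous_def
  proof safe
    have "t \<in> {- \<bar>t\<bar>..\<bar>t\<bar>}" by (simp only: atLeastAtMost_iff, linarith)
    then show "?f v = ?f w" if "\<forall>j\<in>{- \<bar>t\<bar>..\<bar>t\<bar>}. v j = w j" for v w using that by simp
  qed (auto intro!: continuous_intros)
  have lim: "((\<lambda>x. M.expectation (\<lambda>\<omega>. ?f (\<lambda>j. X j \<omega> / \<bar>X 0 \<omega>\<bar>) * of_bool (x < \<bar>X 0 \<omega>\<bar>)) / tail x)
     \<longlongrightarrow> N.expectation (\<lambda>\<omega>. ?f (\<lambda>j. \<Theta> j \<omega>))) at_top"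
    by (rule normalised_spectral_limit[OF wc, where C = 1]) auto
  have "\<forall>\<^sub>F x in at_top. M.expectation (\<lambda>\<omega>. ?f (\<lambda>j. X j \<omega> / \<bar>X 0 \<omega>\<bar>) * of_bool (x < \<bar>X 0 \<omega>\<bar>)) / tail x
      \<le> M.expectation (\<lambda>\<omega>. min 1 (\<bar>X t \<omega>\<bar> / x))"
    using eventually_gt_at_top[of 0]
  proof eventually_elim
    case (elim x)
    have g: "\<bar>min 1 (\<bar>y\<bar> / x)\<bar> \<le> 1" for y using elim by auto
    have "M.expectation (\<lambda>\<omega>. ?f (\<lambda>j. X j \<omega> / \<bar>X 0 \<omega>\<bar>) * of_bool (x < \<bar>X 0 \<omega>\<bar>))
        \<le> M.expectation (\<lambda>\<omega>. min 1 (\<bar>X t \<omega>\<bar> / x) * of_bool (x < \<bar>X 0 \<omega>\<bar>))"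
    proof (rule integral_mono)
      fix \<omega>
      have "\<bar>X t \<omega>\<bar> / \<bar>X 0 \<omega>\<bar> \<le> \<bar>X t \<omega>\<bar> / x" if "x < \<bar>X 0 \<omega>\<bar>"
        using that elim by (intro divide_left_mono) auto
      then show "?f (\<lambda>j. X j \<omega> / \<bar>X 0 \<omega>\<bar>) * of_bool (x < \<bar>X 0 \<omega>\<bar>)
          \<le> min 1 (\<bar>X t \<omega>\<bar> / x) * of_bool (x < \<bar>X 0 \<omega>\<bar>)"
        by auto
    qed (use elim in \<open>auto intro!: M.bounded_expectation[where B = 1]\<close>)
    also have "\<dots> = M.expectation (\<lambda>\<omega>. min 1 (\<bar>X t \<omega>\<bar> / x)) * tail x"
      using g by (intro exceedance_product[OF t]) auto
    finally show ?case using tail_pos[of x] by (simp add: pos_divide_le_eq)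
  qed
  moreover have "((\<lambda>x. M.expectation (\<lambda>\<omega>. min 1 (\<bar>X t \<omega>\<bar> / x))) \<longlongrightarrow> M.expectation (\<lambda>_. 0)) at_top"
  proof (rule integral_dominated_convergence_at_top[where w = "\<lambda>_. 1"])
    show "\<forall>\<^sub>F x in at_top. AE \<omega> in M. norm (min 1 (\<bar>X t \<omega>\<bar> / x)) \<le> 1"
      using eventually_gt_at_top[of 0] by eventually_elim auto
    show "AE \<omega> in M. ((\<lambda>x. min 1 (\<bar>X t \<omega>\<bar> / x)) \<longlongrightarrow> 0) at_top"
    proof (rule AE_I2)
      fix \<omega>
      have "((\<lambda>x. min 1 (\<bar>X t \<omega>\<bar> / x)) \<longlongrightarrow> min 1 0) at_top"
        by (intro tendsto_min tendsto_const tendsto_divide_0[OF tendsto_const] filterlim_at_top_imp_at_infinity filterlim_ident)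
      then show "((\<lambda>x. min 1 (\<bar>X t \<omega>\<bar> / x)) \<longlongrightarrow> 0) at_top" by simp
    qed
  qed auto
  ultimately have "N.expectation (\<lambda>\<omega>. ?f (\<lambda>j. \<Theta> j \<omega>)) \<le> M.expectation (\<lambda>_. 0)"
    by (intro tendsto_le[OF trivial_limit_at_top_linorder _ lim])
  moreover have "0 \<le> N.expectation (\<lambda>\<omega>. ?f (\<lambda>j. \<Theta> j \<omega>))" by (intro integral_nonneg_AE) auto
  ultimately have "N.expectation (\<lambda>\<omega>. ?f (\<lambda>j. \<Theta> j \<omega>)) = 0" by simp
  then have "AE \<omega> in N. ?f (\<lambda>j. \<Theta> j \<omega>) = 0"
    by (subst (asm) integral_nonneg_eq_0_iff_AE) (auto intro!: N.bounded_expectation[where B = 1])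
  then show ?thesis by eventually_elim (auto simp: min_def split: if_splits)
qed

lemma spectral_support: "AE \<omega> in N. \<forall>t. int m < \<bar>t\<bar> \<longrightarrow> \<Theta> t \<omega> = 0"
proof -
  have "AE \<omega> in N. int m < \<bar>t\<bar> \<longrightarrow> \<Theta> t \<omega> = 0" for t
    using spectral_vanishes[of t] by (cases "int m < \<bar>t\<bar>") (auto elim: eventually_mono)
  then show ?thesis by (simp add: AE_all_countable)
qed

lemma cluster_ratio_restrict:
  assumes "\<And>j. int m < \<bar>j\<bar> \<Longrightarrow> v j = 0"
  shows "cluster_ratio a b v = cluster_ratio (max a (- int m)) (min b (int m)) v"
proof -
  have zero: "v j = 0" if "j \<in> {a..b} - {max a (- int m)..min b (int m)}" for j
    using that by (intro assms) (auto split: if_splits)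
  have "sum v {a..b} = sum v {max a (- int m)..min b (int m)}"
    using zero by (intro sum.mono_neutral_right) auto
  moreover have "(\<Sum>j=a..b. (v j)\<^sup>2) = (\<Sum>j=max a (- int m)..min b (int m). (v j)\<^sup>2)"
    using zero by (intro sum.mono_neutral_right) auto
  ultimately show ?thesis by (simp add: cluster_ratio_def)
qed

definition cluster_mean :: real where
  "cluster_mean = N.expectation (\<lambda>\<omega>. cluster_ratio (- int m) (int m) (\<lambda>j. \<Theta> j \<omega>))"

lemma expectation_cluster_ratio:
  assumes "a \<le> - int m" "int m \<le> b"
  shows "N.expectation (\<lambda>\<omega>. cluster_ratio a b (\<lambda>j. \<Theta> j \<omega>)) = cluster_mean"
  unfolding cluster_mean_def
proof (rule integral_cong_AE)
  show "AE \<omega> in N. cluster_ratio a b (\<lambda>j. \<Theta> j \<omega>) = cluster_ratio (- int m) (int m) (\<lambda>j. \<Theta> j \<omega>)"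
    using spectral_support by eventually_elim (use assms in \<open>simp add: cluster_ratio_restrict[of _ a b]\<close>)
qed auto

lemma expectation_cluster_ratio_bounds:
  "0 \<le> N.expectation (\<lambda>\<omega>. cluster_ratio a b (\<lambda>j. \<Theta> j \<omega>))"
  "N.expectation (\<lambda>\<omega>. cluster_ratio a b (\<lambda>j. \<Theta> j \<omega>)) \<le> 2 * real m + 1"
proof -
  show "0 \<le> N.expectation (\<lambda>\<omega>. cluster_ratio a b (\<lambda>j. \<Theta> j \<omega>))" by (intro integral_nonneg_AE) auto
  have le: "AE \<omega> in N. cluster_ratio a b (\<lambda>j. \<Theta> j \<omega>) \<le> 2 * real m + 1"
    using spectral_support
  proof eventually_elim
    case (elim \<omega>)
    have "cluster_ratio a b (\<lambda>j. \<Theta> j \<omega>) \<le> real (card {max a (- int m)..min b (int m)})"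
      using elim by (subst cluster_ratio_restrict) (auto intro: cluster_ratio_le simp del: card_atLeastAtMost_int)
    also have "\<dots> \<le> real (card {- int m..int m})"
      by (intro of_nat_mono card_mono) auto
    finally show ?case by simp
  qed
  have "N.expectation (\<lambda>\<omega>. cluster_ratio a b (\<lambda>j. \<Theta> j \<omega>)) \<le> N.expectation (\<lambda>_. 2 * real m + 1)"
  proof (rule integral_mono_AE[OF _ _ le])
    show "integrable N (\<lambda>\<omega>. cluster_ratio a b (\<lambda>j. \<Theta> j \<omega>))"
      using le by (intro N.integrable_const_bound[where B = "2 * real m + 1"]) auto
  qed simp
  then show "N.expectation (\<lambda>\<omega>. cluster_ratio a b (\<lambda>j. \<Theta> j \<omega>)) \<le> 2 * real m + 1"
    by (simp add: N.prob_space)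
qed

text \<open>The limit in \<open>block_second_moment_limit\<close> for the block length \<open>r\<close>.\<close>

definition block_limit :: "nat \<Rightarrow> real" where
  "block_limit r = (\<Sum>t=1..int r. N.expectation (\<lambda>\<omega>. cluster_ratio (1 - t) (int r - t) (\<lambda>j. \<Theta> j \<omega>)))"

text \<open>The window seen from a time \<open>t\<close> with \<open>m < t \<le> r - m\<close> covers the support of \<open>\<Theta>\<close>, so its term equals
\<open>cluster_mean\<close>; the at most \<open>2 m\<close> remaining terms are bounded.\<close>

lemma block_limit_average: "(\<lambda>r. block_limit r / real r) \<longlonglongrightarrow> cluster_mean"
proof -
  let ?e = "\<lambda>r t. N.expectation (\<lambda>\<omega>. cluster_ratio (1 - t) (int r - t) (\<lambda>j. \<Theta> j \<omega>))"
  have mean: "0 \<le> cluster_mean" "cluster_mean \<le> 2 * real m + 1"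
    unfolding cluster_mean_def by (rule expectation_cluster_ratio_bounds)+
  have bound: "\<bar>block_limit r / real r - cluster_mean\<bar> \<le> (2 * real m + 1) * (2 * real m) * (1 / real r)"
    if r: "0 < r" for r
  proof -
    let ?P = "\<lambda>t. t \<le> int m \<or> int r - int m < t"
    have "\<bar>?e r t - cluster_mean\<bar> \<le> (2 * real m + 1) * of_bool (?P t)" if "t \<in> {1..int r}" for t
    proof (cases "?P t")
      case True
      have "\<bar>?e r t - cluster_mean\<bar> \<le> 2 * real m + 1"
        using expectation_cluster_ratio_bounds[of "1 - t" "int r - t"] mean by linarith
      with True show ?thesis by simp
    next
      case False
      then have "?e r t = cluster_mean" by (intro expectation_cluster_ratio) auto
      with False show ?thesis by simp
    qed
    then have "\<bar>\<Sum>t=1..int r. ?e r t - cluster_mean\<bar> \<le> (\<Sum>t=1..int r. (2 * real m + 1) * of_bool (?P t))"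
      by (intro order_trans[OF sum_abs sum_mono])
    also have "\<dots> = (2 * real m + 1) * real (card ({1..int r} \<inter> Collect ?P))"
      by (simp add: sum_distrib_left[symmetric] sum.If_cases of_bool_def)
    also have "\<dots> \<le> (2 * real m + 1) * (2 * real m)"
    proof -
      have "{1..int r} \<inter> Collect ?P \<subseteq> {1..int m} \<union> {int r - int m + 1..int r}" by auto
      then have "card ({1..int r} \<inter> Collect ?P) \<le> card ({1..int m} \<union> {int r - int m + 1..int r})"
        by (intro card_mono) auto
      also have "\<dots> \<le> card {1..int m} + card {int r - int m + 1..int r}" by (rule card_Un_le)
      also have "\<dots> = 2 * m" by simp
      finally have "real (card ({1..int r} \<inter> Collect ?P)) \<le> real (2 * m)" by (rule of_nat_mono)
      then show ?thesis by (intro mult_left_mono) auto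
    qed
    finally have "\<bar>block_limit r - real r * cluster_mean\<bar> \<le> (2 * real m + 1) * (2 * real m)"
      by (simp add: block_limit_def sum_subtractf)
    moreover have "block_limit r / real r - cluster_mean = (block_limit r - real r * cluster_mean) / real r"
      using r by (simp add: field_simps)
    ultimately show ?thesis using r by (simp add: abs_divide divide_right_mono)
  qed
  have "(\<lambda>r. block_limit r / real r - cluster_mean) \<longlonglongrightarrow> 0"
  proof (rule Lim_null_comparison)
    show "\<forall>\<^sub>F r in sequentially. norm (block_limit r / real r - cluster_mean)
        \<le> (2 * real m + 1) * (2 * real m) * (1 / real r)"
      using eventually_gt_at_top[of 0] by eventually_elim (use bound in auto)
    show "(\<lambda>r. (2 * real m + 1) * (2 * real m) * (1 / real r)) \<longlonglongrightarrow> 0"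
      using tendsto_mult[OF tendsto_const lim_1_over_n, of "(2 * real m + 1) * (2 * real m)"] by simp
  qed
  then show ?thesis by (simp add: LIM_zero_iff)
qed

text \<open>On the event that \<open>\<Theta>\<close> vanishes at the \<open>m\<close> times before 0, the squared sum equals
\<open>(\<Sum>s=0..m. (\<Theta> s)\<^sup>2)\<close> times the cluster ratio. The time change by \<open>s\<close> turns the \<open>s\<close>-th term into the
expectation of the cluster ratio on the event that \<open>- s\<close> is the first nonzero index, and these
events almost surely form a partition.\<close>

lemma cluster_variance:
  defines "\<Sigma> \<equiv> \<lambda>\<omega>. (\<Sum>t=0..m. \<Theta> (int t) \<omega>)\<^sup>2 * of_bool (\<forall>i\<in>{1..m}. \<Theta> (- int i) \<omega> = 0)"
  shows "integrable N \<Sigma>" and "N.expectation \<Sigma> = cluster_mean"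
proof -
  \<comment> \<open>Shifted by any \<open>s \<le> m\<close>, the window \<open>{-2m..2m}\<close> still contains \<open>{-m..m}\<close>.\<close>
  let ?h = "2 * int m"
  let ?P = "\<lambda>\<omega>. \<forall>i\<in>{1..m}. \<Theta> (- int i) \<omega> = 0"
  let ?u = "\<lambda>s \<omega>. cluster_ratio (- ?h) ?h (\<lambda>j. \<Theta> j \<omega>) * ((\<Theta> s \<omega>)\<^sup>2 * of_bool (?P \<omega>))"
  let ?w = "\<lambda>s \<omega>. cluster_ratio (- ?h - s) (?h - s) (\<lambda>j. \<Theta> j \<omega>) * of_bool (cluster_starts m (\<lambda>j. \<Theta> j \<omega>) s)"
  have int_u: "integrable N (?u s)" and exp_u: "N.expectation (?u s) = N.expectation (?w s)"
    if "s \<in> {0..int m}" for s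
    by (rule time_change_first_index; use that in simp)+
  have [measurable]: "\<Sigma> \<in> borel_measurable N" unfolding \<Sigma>_def by measurable
  have \<Sigma>_eq: "AE \<omega> in N. (\<Sum>s=0..int m. ?u s \<omega>) = \<Sigma> \<omega>"
    using spectral_support abs_\<Theta>_0
  proof eventually_elim
    case (elim \<omega>)
    show ?case
    proof (cases "?P \<omega>")
      case True
      have zero: "\<Theta> j \<omega> = 0" if "j \<in> {- ?h..?h} - {0..int m}" for j
      proof (cases "int m < \<bar>j\<bar>")
        case False
        then have "nat (- j) \<in> {1..m}" using that by auto
        then have "\<Theta> (- int (nat (- j))) \<omega> = 0" using True by blast
        then show ?thesis using False that by auto
      qed (use elim in auto)
      define Q where "Q = (\<Sum>j=0..int m. (\<Theta> j \<omega>)\<^sup>2)"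
      have "(\<Theta> 0 \<omega>)\<^sup>2 \<le> Q" unfolding Q_def by (intro member_le_sum) auto
      moreover have "(\<Theta> 0 \<omega>)\<^sup>2 = 1" using elim by (metis one_power2 power2_abs)
      ultimately have Q: "1 \<le> Q" by simp
      have sum1: "(\<Sum>j=- ?h..?h. \<Theta> j \<omega>) = (\<Sum>j=0..int m. \<Theta> j \<omega>)"
        using zero by (intro sum.mono_neutral_right) auto
      have sum2: "(\<Sum>j=- ?h..?h. (\<Theta> j \<omega>)\<^sup>2) = Q"
        unfolding Q_def using zero by (intro sum.mono_neutral_right) auto
      have nat_sum: "(\<Sum>t=0..m. \<Theta> (int t) \<omega>) = (\<Sum>j=0..int m. \<Theta> j \<omega>)"
        by (rule sum.reindex_bij_witness[of _ nat int]) auto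
      have "(\<Sum>s=0..int m. ?u s \<omega>) = cluster_ratio (- ?h) ?h (\<lambda>j. \<Theta> j \<omega>) * Q"
        using True unfolding Q_def sum_distrib_left by (intro sum.cong) auto
      also have "\<dots> = (\<Sum>j=0..int m. \<Theta> j \<omega>)\<^sup>2"
        unfolding cluster_ratio_def sum1 sum2 using Q by simp
      finally show ?thesis using True by (simp add: \<Sigma>_def nat_sum)
    next
      case False
      show ?thesis
        unfolding \<Sigma>_def by (simp only: False of_bool_eq mult_zero_right sum.neutral_const)
    qed
  qed
  have int_sum: "integrable N (\<lambda>\<omega>. \<Sum>s=0..int m. ?u s \<omega>)"
    by (intro Bochner_Integration.integrable_sum int_u)
  show "integrable N \<Sigma>"
    by (rule Bochner_Integration.integrable_cong_AE_imp[OF int_sum _ \<Sigma>_eq]) measurable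
  have "N.expectation \<Sigma> = N.expectation (\<lambda>\<omega>. \<Sum>s=0..int m. ?u s \<omega>)"
    using \<Sigma>_eq by (intro integral_cong_AE) (auto elim: eventually_mono)
  also have "\<dots> = (\<Sum>s=0..int m. N.expectation (?w s))"
    using int_u exp_u by (simp add: Bochner_Integration.integral_sum)
  also have "\<dots> = N.expectation (\<lambda>\<omega>. \<Sum>s=0..int m. ?w s \<omega>)"
  proof (rule Bochner_Integration.integral_sum[symmetric])
    fix s
    show "integrable N (?w s)"
    proof (rule N.bounded_expectation[where B = "real (card {- ?h - s..?h - s})"])
      show "?w s \<in> borel_measurable N" unfolding cluster_starts_def by measurable
      show "\<bar>?w s \<omega>\<bar> \<le> real (card {- ?h - s..?h - s})" for \<omega>
        using cluster_ratio_le[of "- ?h - s" "?h - s" "\<lambda>j. \<Theta> j \<omega>"] by (auto simp: abs_mult)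
    qed
  qed
  also have "\<dots> = cluster_mean"
    unfolding cluster_mean_def
  proof (rule integral_cong_AE)
    show "AE \<omega> in N. (\<Sum>s=0..int m. ?w s \<omega>) = cluster_ratio (- int m) (int m) (\<lambda>j. \<Theta> j \<omega>)"
      using spectral_support abs_\<Theta>_0
    proof eventually_elim
      case (elim \<omega>)
      have "?w s \<omega> = cluster_ratio (- int m) (int m) (\<lambda>j. \<Theta> j \<omega>) * of_bool (cluster_starts m (\<lambda>j. \<Theta> j \<omega>) s)"
        if "s \<in> {0..int m}" for s
      proof -
        have "max (- ?h - s) (- int m) = - int m" "min (?h - s) (int m) = int m" using that by auto
        then show ?thesis using elim by (simp add: cluster_ratio_restrict[of _ "- ?h - s"])
      qed
      then have "(\<Sum>s=0..int m. ?w s \<omega>) = cluster_ratio (- int m) (int m) (\<lambda>j. \<Theta> j \<omega>) *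
          (\<Sum>s=0..int m. of_bool (cluster_starts m (\<lambda>j. \<Theta> j \<omega>) s))"
        unfolding sum_distrib_left by (intro sum.cong) auto
      also have "(\<Sum>s=0..int m. of_bool (cluster_starts m (\<lambda>j. \<Theta> j \<omega>) s) :: real) = 1"
        using elim by (intro sum_cluster_starts) auto
      finally show ?case by simp
    qed
    show "(\<lambda>\<omega>. \<Sum>s=0..int m. ?w s \<omega>) \<in> borel_measurable N"
      unfolding cluster_starts_def by measurable
  qed measurable
  finally show "N.expectation \<Sigma> = cluster_mean" .
qed

end

section \<open>Growing blocks\<close>

text \<open>Take \<open>\<rho> n\<close> to be the largest \<open>k \<le> n\<close> whose property is already known to hold from \<open>n\<close> on.\<close>

lemma diagonal_thresholds:
  fixes P :: "nat \<Rightarrow> nat \<Rightarrow> bool"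
  assumes "\<And>k. \<forall>\<^sub>F n in sequentially. P k n"
  obtains \<rho> :: "nat \<Rightarrow> nat" where "filterlim \<rho> at_top sequentially" "\<And>n. 1 \<le> \<rho> n"
    "\<forall>\<^sub>F n in sequentially. P (\<rho> n) n"
proof -
  have "\<forall>k. \<exists>N. \<forall>n\<ge>N. P k n" using assms by (simp add: eventually_sequentially)
  then obtain N where N: "\<And>k n. N k \<le> n \<Longrightarrow> P k n" by metis
  define A where "A n = {k. 1 \<le> k \<and> k \<le> n \<and> N k \<le> n}" for n
  define \<rho> where "\<rho> n = Max (insert 1 (A n))" for n
  have fin: "finite (A n)" for n unfolding A_def by simp
  have ge: "k \<le> \<rho> n" if "k \<in> insert 1 (A n)" for k n
    unfolding \<rho>_def using fin that by (intro Max_ge) auto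
  show ?thesis
  proof
    show "1 \<le> \<rho> n" for n by (rule ge) simp
    show "filterlim \<rho> at_top sequentially"
      unfolding filterlim_at_top
    proof
      fix k
      show "\<forall>\<^sub>F n in sequentially. k \<le> \<rho> n"
        using eventually_ge_at_top[of "max (Suc k) (N (Suc k))"]
      proof eventually_elim
        case (elim n)
        then have "Suc k \<le> \<rho> n" by (intro ge) (auto simp: A_def)
        then show ?case by simp
      qed
    qed
    show "\<forall>\<^sub>F n in sequentially. P (\<rho> n) n"
      using eventually_ge_at_top[of "max 1 (N 1)"]
    proof eventually_elim
      case (elim n)
      then have "1 \<in> A n" by (auto simp: A_def)
      then have "\<rho> n \<in> A n"
        unfolding \<rho>_def using fin[of n] by (metis Max_in empty_iff finite_insert insert_absorb)
      then show ?case by (intro N) (auto simp: A_def)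
    qed
  qed
qed

lemma floor_divide_average:
  assumes "0 < r"
  shows "(\<lambda>n. real_of_int \<lfloor>real n / real r\<rfloor> / real n) \<longlonglongrightarrow> 1 / real r"
proof (rule tendsto_sandwich[where f = "\<lambda>n. 1 / real r - 1 / real n" and h = "\<lambda>_. 1 / real r"])
  show "\<forall>\<^sub>F n in sequentially. 1 / real r - 1 / real n \<le> real_of_int \<lfloor>real n / real r\<rfloor> / real n"
    using eventually_gt_at_top[of 0]
  proof eventually_elim
    case (elim n)
    have "real n / real r - 1 \<le> real_of_int \<lfloor>real n / real r\<rfloor>" by linarith
    then have "(real n / real r - 1) / real n \<le> real_of_int \<lfloor>real n / real r\<rfloor> / real n"
      by (intro divide_right_mono) auto
    then show ?case using elim by (simp add: diff_divide_distrib)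
  qed
  show "\<forall>\<^sub>F n in sequentially. real_of_int \<lfloor>real n / real r\<rfloor> / real n \<le> 1 / real r"
    using eventually_gt_at_top[of 0]
  proof eventually_elim
    case (elim n)
    have "real_of_int \<lfloor>real n / real r\<rfloor> / real n \<le> (real n / real r) / real n"
      by (intro divide_right_mono of_int_floor_le) auto
    then show ?case using elim by simp
  qed
  show "(\<lambda>n. 1 / real r - 1 / real n) \<longlonglongrightarrow> 1 / real r"
    using tendsto_diff[OF tendsto_const lim_1_over_n, of "1 / real r"] by simp
qed simp

context heavy_tailed_sequence
begin

lemma trunc_eq:
  assumes "0 < x"
  shows "x\<^sup>2 * M.prob {\<omega> \<in> space M. \<bar>X 0 \<omega>\<bar> > x} + M.expectation (\<lambda>\<omega>. (X 0 \<omega>)\<^sup>2 * of_bool (\<bar>X 0 \<omega>\<bar> \<le> x)) = trunc x"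
proof -
  have split: "min ((X 0 \<omega>)\<^sup>2) (x\<^sup>2) = x\<^sup>2 * of_bool (x < \<bar>X 0 \<omega>\<bar>) + (X 0 \<omega>)\<^sup>2 * of_bool (\<bar>X 0 \<omega>\<bar> \<le> x)" for \<omega>
    using power_mono[of "\<bar>X 0 \<omega>\<bar>" x 2] power_mono[of x "\<bar>X 0 \<omega>\<bar>" 2] assms by (cases "x < \<bar>X 0 \<omega>\<bar>") auto
  have i1: "integrable M (\<lambda>\<omega>. x\<^sup>2 * of_bool (x < \<bar>X 0 \<omega>\<bar>))"
    by (rule M.bounded_expectation[where B = "x\<^sup>2"]) auto
  have i2: "integrable M (\<lambda>\<omega>. (X 0 \<omega>)\<^sup>2 * of_bool (\<bar>X 0 \<omega>\<bar> \<le> x))"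
  proof (rule M.bounded_expectation[where B = "x\<^sup>2"])
    show "\<bar>(X 0 \<omega>)\<^sup>2 * of_bool (\<bar>X 0 \<omega>\<bar> \<le> x)\<bar> \<le> x\<^sup>2" for \<omega>
      using power_mono[of "\<bar>X 0 \<omega>\<bar>" x 2] by auto
  qed simp
  show ?thesis
    unfolding trunc_def split Bochner_Integration.integral_add[OF i1 i2]
    by (simp add: tail_eq_prob flip: tail_def)
qed

lemma stationary_marginal: "distr M borel (X t) = distr M borel (X 0)"
proof -
  let ?P = "Pi\<^sub>M UNIV (\<lambda>_::int. borel :: real measure)"
  have m: "(\<lambda>\<omega> j. X (j + s) \<omega>) \<in> measurable M ?P" for s
    by (intro measurable_PiM_single') auto
  have marginal: "distr M borel (X s) = distr (distr M ?P (\<lambda>\<omega> j. X (j + s) \<omega>)) borel (\<lambda>v. v 0)" for s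
    by (subst distr_distr[OF _ m]) (auto simp: comp_def)
  have shift: "distr M ?P (\<lambda>\<omega> j. X (j + s) \<omega>) = distr M ?P (\<lambda>\<omega> j. X j \<omega>)" for s
    using stationary by (simp add: strictly_stationary_def)
  show ?thesis
    by (rule trans[OF marginal[of t, unfolded shift] marginal[of 0, unfolded shift, symmetric]])
qed

lemma expectation_abs_sum_le:
  assumes int: "integrable M (X 0)"
  shows "integrable M (\<lambda>\<omega>. \<Sum>j=1..int r. X j \<omega>)"
    and "M.expectation (\<lambda>\<omega>. \<bar>\<Sum>j=1..int r. X j \<omega>\<bar>) \<le> real r * M.expectation (\<lambda>\<omega>. \<bar>X 0 \<omega>\<bar>)"
proof -
  have intX: "integrable M (X t)" for t
  proof -
    have "integrable (distr M borel (X 0)) (\<lambda>y. y)"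
      using int by (simp add: integrable_distr_eq)
    then have "integrable (distr M borel (X t)) (\<lambda>y. y)"
      by (subst stationary_marginal)
    then show ?thesis by (simp add: integrable_distr_eq)
  qed
  have absX: "M.expectation (\<lambda>\<omega>. \<bar>X t \<omega>\<bar>) = M.expectation (\<lambda>\<omega>. \<bar>X 0 \<omega>\<bar>)" for t
  proof -
    have "M.expectation (\<lambda>\<omega>. \<bar>X s \<omega>\<bar>) = integral\<^sup>L (distr M borel (X s)) (\<lambda>y. \<bar>y\<bar>)" for s
      by (simp add: integral_distr)
    note abs_distr = this
    show ?thesis
      by (rule trans[OF abs_distr[of t] trans[OF _ abs_distr[of 0, symmetric]]])
        (rule arg_cong[OF stationary_marginal])
  qed
  show int_sum: "integrable M (\<lambda>\<omega>. \<Sum>j=1..int r. X j \<omega>)"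
    by (intro Bochner_Integration.integrable_sum intX)
  have "M.expectation (\<lambda>\<omega>. \<bar>\<Sum>j=1..int r. X j \<omega>\<bar>) \<le> M.expectation (\<lambda>\<omega>. \<Sum>j=1..int r. \<bar>X j \<omega>\<bar>)"
    by (intro integral_mono integrable_abs int_sum Bochner_Integration.integrable_sum intX sum_abs)
  also have "\<dots> = (\<Sum>j=1..int r. M.expectation (\<lambda>\<omega>. \<bar>X j \<omega>\<bar>))"
    by (intro Bochner_Integration.integral_sum integrable_abs intX)
  also have "\<dots> = (\<Sum>j=1..int r. M.expectation (\<lambda>\<omega>. \<bar>X 0 \<omega>\<bar>))"
    by (intro sum.cong refl absX)
  also have "\<dots> = real r * M.expectation (\<lambda>\<omega>. \<bar>X 0 \<omega>\<bar>)" by simp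
  finally show "M.expectation (\<lambda>\<omega>. \<bar>\<Sum>j=1..int r. X j \<omega>\<bar>) \<le> real r * M.expectation (\<lambda>\<omega>. \<bar>X 0 \<omega>\<bar>)" .
qed

lemma trunc_ratio_antimono:
  assumes "0 < x" "x \<le> y"
  shows "trunc y / y\<^sup>2 \<le> trunc x / x\<^sup>2"
proof -
  have "trunc y * x\<^sup>2 = M.expectation (\<lambda>\<omega>. min ((X 0 \<omega>)\<^sup>2) (y\<^sup>2) * x\<^sup>2)" by (simp add: trunc_def)
  also have "\<dots> \<le> M.expectation (\<lambda>\<omega>. min ((X 0 \<omega>)\<^sup>2) (x\<^sup>2) * y\<^sup>2)"
  proof (rule integral_mono)
    fix \<omega>
    have xy: "x\<^sup>2 \<le> y\<^sup>2" using assms by (intro power_mono) auto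
    have "min ((X 0 \<omega>)\<^sup>2) (y\<^sup>2) * x\<^sup>2 = min ((X 0 \<omega>)\<^sup>2 * x\<^sup>2) (y\<^sup>2 * x\<^sup>2)"
      by (simp add: min_mult_distrib_right)
    also have "\<dots> \<le> min ((X 0 \<omega>)\<^sup>2 * y\<^sup>2) (x\<^sup>2 * y\<^sup>2)"
      using xy by (intro min.mono) (auto simp: mult.commute[of "y\<^sup>2"] intro!: mult_left_mono)
    also have "\<dots> = min ((X 0 \<omega>)\<^sup>2) (x\<^sup>2) * y\<^sup>2" by (simp add: min_mult_distrib_right)
    finally show "min ((X 0 \<omega>)\<^sup>2) (y\<^sup>2) * x\<^sup>2 \<le> min ((X 0 \<omega>)\<^sup>2) (x\<^sup>2) * y\<^sup>2" .
  qed auto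
  also have "\<dots> = trunc x * y\<^sup>2" by (simp add: trunc_def)
  finally show ?thesis using assms by (simp add: field_simps)
qed

text \<open>Since \<open>trunc (a n) / (a n)\<^sup>2 = 1 / n\<close> tends to 0 and \<open>trunc x / x\<^sup>2\<close> is positive and decreasing in \<open>x\<close>, the sequence cannot
stay bounded along a subsequence.\<close>

lemma norming_at_top:
  fixes a :: "nat \<Rightarrow> real"
  assumes "\<forall>\<^sub>F n in sequentially. 0 < a n \<and> real n * trunc (a n) = (a n)\<^sup>2"
  shows "filterlim a at_top sequentially"
  unfolding filterlim_at_top_gt[where c = 0]
proof (intro allI impI)
  fix Z :: real assume Z: "0 < Z"
  define p where "p = trunc Z / Z\<^sup>2"
  have p: "0 < p" using trunc_pos[OF Z] Z by (simp add: p_def)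
  have "\<forall>\<^sub>F n in sequentially. 1 / p < real n"
    using filterlim_real_sequentially unfolding filterlim_at_top_dense by blast
  with assms show "\<forall>\<^sub>F n in sequentially. Z \<le> a n"
  proof eventually_elim
    case (elim n)
    have n: "0 < real n" using elim(2) p by (smt (verit) divide_pos_pos)
    show ?case
    proof (rule ccontr)
      assume "\<not> Z \<le> a n"
      then have "p \<le> trunc (a n) / (a n)\<^sup>2"
        unfolding p_def using elim(1) by (intro trunc_ratio_antimono) auto
      also have "\<dots> = 1 / real n" using elim(1) n by (simp add: field_simps)
      finally show False using elim(2) p n by (simp add: field_simps)
    qed
  qed
qed

end

context m_dependent_heavy_tailed_sequence
begin

text \<open>For a fixed block length the limit holds uniformly for the truncation level in a compact interval of positive
numbers: the second moment is monotone in that level, so its values at the two end points suffice, and the square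
of the mean is at most \<open>(r E|X 0| / a n)\<^sup>2\<close> whatever the level, with \<open>n / (a n)\<^sup>2 = 1 / trunc (a n)\<close> tending
to 0.\<close>

lemma block_variance_limit:
  fixes a :: "nat \<Rightarrow> real" and r :: nat
  defines "S \<equiv> \<lambda>n::nat. \<lambda>\<omega>. \<Sum>t=1..n. X (int t) \<omega>"
  defines "q \<equiv> \<lambda>n \<epsilon>. real_of_int \<lfloor>real n / real r\<rfloor> *
      M.variance (\<lambda>\<omega>. S r \<omega> / a n * of_bool (\<bar>S r \<omega> / a n\<bar> \<le> \<epsilon>))"
  assumes int: "integrable M (X 0)"
    and norming: "\<forall>\<^sub>F n in sequentially. 0 < a n \<and> real n * trunc (a n) = (a n)\<^sup>2"
    and r: "1 \<le> r" and \<epsilon>: "0 < lo" and e: "0 < e"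
  shows "\<forall>\<^sub>F n in sequentially. \<forall>\<epsilon>\<in>{lo..hi}. \<bar>q n \<epsilon> - block_limit r / real r\<bar> \<le> e"
proof -
  define c where "c = M.expectation (\<lambda>\<omega>. \<bar>X 0 \<omega>\<bar>)"
  define T where "T n \<epsilon> \<omega> = S r \<omega> / a n * of_bool (\<bar>S r \<omega> / a n\<bar> \<le> \<epsilon>)" for n \<epsilon> \<omega>
  define E2 where "E2 n \<epsilon> = M.expectation (\<lambda>\<omega>. (T n \<epsilon> \<omega>)\<^sup>2)" for n \<epsilon>
  define H where "H n \<epsilon> = real_of_int \<lfloor>real n / real r\<rfloor> * E2 n \<epsilon>" for n \<epsilon>
  define D where "D n = real r * c\<^sup>2 / trunc (a n)" for n
  have S_int: "S r \<omega> = (\<Sum>j=1..int r. X j \<omega>)" for \<omega>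
    unfolding S_def by (rule sum.reindex_bij_witness[of _ nat int]) auto
  have [measurable]: "S r \<in> borel_measurable M" unfolding S_def by measurable
  have [measurable]: "T n \<epsilon> \<in> borel_measurable M" for n \<epsilon> unfolding T_def by measurable
  have T_abs: "\<bar>T n \<epsilon> \<omega>\<bar> \<le> \<bar>\<epsilon>\<bar>" for n \<epsilon> \<omega> unfolding T_def by auto
  have int_T: "integrable M (T n \<epsilon>)" for n \<epsilon>
    by (rule M.bounded_expectation[OF _ T_abs]) simp
  have int_T2: "integrable M (\<lambda>\<omega>. (T n \<epsilon> \<omega>)\<^sup>2)" for n \<epsilon>
  proof (rule M.bounded_expectation[where B = "\<epsilon>\<^sup>2"])
    show "\<bar>(T n \<epsilon> \<omega>)\<^sup>2\<bar> \<le> \<epsilon>\<^sup>2" for \<omega> using power_mono[OF T_abs, of n \<epsilon> \<omega> 2] by simp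
  qed simp
  have a_top: "filterlim a at_top sequentially" by (rule norming_at_top[OF norming])
  have H_lim: "(\<lambda>n. H n \<epsilon>) \<longlonglongrightarrow> block_limit r / real r" if "0 < \<epsilon>" for \<epsilon>
  proof -
    have "((\<lambda>x. M.expectation (\<lambda>\<omega>. (S r \<omega>)\<^sup>2 * of_bool (\<bar>S r \<omega>\<bar> \<le> \<epsilon> * x)) / trunc x) \<longlongrightarrow> block_limit r) at_top"
      unfolding S_int block_limit_def using r by (intro block_second_moment_limit that) simp
    from tendsto_mult[OF floor_divide_average filterlim_compose[OF this a_top], of r]
    have "(\<lambda>n. real_of_int \<lfloor>real n / real r\<rfloor> / real n *
        (M.expectation (\<lambda>\<omega>. (S r \<omega>)\<^sup>2 * of_bool (\<bar>S r \<omega>\<bar> \<le> \<epsilon> * a n)) / trunc (a n)))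
        \<longlonglongrightarrow> block_limit r / real r"
      using r by simp
    moreover have "\<forall>\<^sub>F n in sequentially. real_of_int \<lfloor>real n / real r\<rfloor> / real n *
        (M.expectation (\<lambda>\<omega>. (S r \<omega>)\<^sup>2 * of_bool (\<bar>S r \<omega>\<bar> \<le> \<epsilon> * a n)) / trunc (a n)) = H n \<epsilon>"
      using norming
    proof eventually_elim
      case (elim n)
      have "(T n \<epsilon> \<omega>)\<^sup>2 = (S r \<omega>)\<^sup>2 * of_bool (\<bar>S r \<omega>\<bar> \<le> \<epsilon> * a n) / (a n)\<^sup>2" for \<omega>
        unfolding T_def using elim by (simp add: power_mult_distrib power_divide pos_divide_le_eq)
      then have "E2 n \<epsilon> = M.expectation (\<lambda>\<omega>. (S r \<omega>)\<^sup>2 * of_bool (\<bar>S r \<omega>\<bar> \<le> \<epsilon> * a n)) / (real n * trunc (a n))"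
        unfolding E2_def using elim by simp
      then show ?case by (simp add: H_def)
    qed
    ultimately show ?thesis by (simp add: filterlim_cong[OF refl refl])
  qed
  have D_lim: "D \<longlonglongrightarrow> 0"
    unfolding D_def
    by (intro tendsto_divide_0[OF tendsto_const] filterlim_at_top_imp_at_infinity
        filterlim_compose[OF trunc_at_top a_top])
  have mean_le: "real_of_int \<lfloor>real n / real r\<rfloor> * (M.expectation (T n \<epsilon>))\<^sup>2 \<le> D n"
    if n: "0 < a n" "real n * trunc (a n) = (a n)\<^sup>2" for n \<epsilon>
  proof -
    have "\<bar>M.expectation (T n \<epsilon>)\<bar> \<le> M.expectation (\<lambda>\<omega>. \<bar>T n \<epsilon> \<omega>\<bar>)" by (rule integral_abs_bound)
    also have "\<dots> \<le> M.expectation (\<lambda>\<omega>. \<bar>S r \<omega>\<bar> / a n)"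
    proof (rule integral_mono)
      show "integrable M (\<lambda>\<omega>. \<bar>S r \<omega>\<bar> / a n)"
        using expectation_abs_sum_le(1)[OF int, of r] unfolding S_int
        by (intro integrable_divide integrable_abs) auto
      show "\<bar>T n \<epsilon> \<omega>\<bar> \<le> \<bar>S r \<omega>\<bar> / a n" for \<omega> using n(1) by (simp add: T_def)
    qed (rule integrable_abs[OF int_T])
    also have "\<dots> = M.expectation (\<lambda>\<omega>. \<bar>S r \<omega>\<bar>) / a n" by simp
    also have "\<dots> \<le> real r * c / a n"
      using n(1) expectation_abs_sum_le(2)[OF int, of r] unfolding S_int c_def
      by (intro divide_right_mono) auto
    finally have "(M.expectation (T n \<epsilon>))\<^sup>2 \<le> (real r * c / a n)\<^sup>2"
      using power_mono[of "\<bar>M.expectation (T n \<epsilon>)\<bar>" "real r * c / a n" 2] by simp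
    then have "real_of_int \<lfloor>real n / real r\<rfloor> * (M.expectation (T n \<epsilon>))\<^sup>2
        \<le> real n / real r * (real r * c / a n)\<^sup>2"
      by (intro mult_mono of_int_floor_le) auto
    also have "\<dots> = D n"
    proof -
      have "trunc (a n) > 0" using n by (intro trunc_pos)
      moreover have "real n \<noteq> 0"
      proof
        assume "real n = 0"
        with n(2) have "a n = 0" by simp
        with n(1) show False by simp
      qed
      ultimately show ?thesis
        using r n by (simp add: D_def power_mult_distrib power_divide flip: n(2)) (simp add: field_simps power2_eq_square)
    qed
    finally show ?thesis .
  qed
  have q_eq: "q n \<epsilon> = H n \<epsilon> - real_of_int \<lfloor>real n / real r\<rfloor> * (M.expectation (T n \<epsilon>))\<^sup>2" for n \<epsilon>
  proof -
    have "M.variance (T n \<epsilon>) = E2 n \<epsilon> - (M.expectation (T n \<epsilon>))\<^sup>2"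
      unfolding E2_def by (rule M.variance_eq[OF int_T int_T2])
    then show ?thesis unfolding q_def H_def T_def by (simp add: right_diff_distrib)
  qed
  have H_mono: "H n \<epsilon> \<le> H n \<epsilon>'" if "\<epsilon> \<le> \<epsilon>'" for n \<epsilon> \<epsilon>'
    unfolding H_def E2_def
  proof (intro mult_left_mono integral_mono int_T2)
    show "(T n \<epsilon> \<omega>)\<^sup>2 \<le> (T n \<epsilon>' \<omega>)\<^sup>2" for \<omega> using that unfolding T_def by auto
  qed simp
  \<comment> \<open>The maximum covers the case of an empty interval.\<close>
  have "\<forall>\<^sub>F n in sequentially. H n (max lo hi) < block_limit r / real r + e"
    using \<epsilon> e by (intro order_tendstoD(2)[OF H_lim]) auto
  moreover have "\<forall>\<^sub>F n in sequentially. block_limit r / real r - e < H n lo - D n"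
    using \<epsilon> e by (intro order_tendstoD(1)[OF tendsto_diff[OF H_lim D_lim]]) auto
  ultimately show ?thesis using norming
  proof eventually_elim
    case (elim n)
    show ?case
    proof
      fix \<epsilon> assume "\<epsilon> \<in> {lo..hi}"
      then have "H n lo \<le> H n \<epsilon>" "H n \<epsilon> \<le> H n (max lo hi)" by (auto intro!: H_mono)
      moreover have "0 \<le> real_of_int \<lfloor>real n / real r\<rfloor> * (M.expectation (T n \<epsilon>))\<^sup>2" by simp
      ultimately show "\<bar>q n \<epsilon> - block_limit r / real r\<bar> \<le> e"
        using elim mean_le[of n \<epsilon>] unfolding q_eq by linarith
    qed
  qed
qed

text \<open>The diagonal argument: \<open>P k n\<close> expresses that the error is at most \<open>1 / k\<close> for all block lengths up to \<open>k\<close>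
and all levels in \<open>{1 / k..k}\<close>. Along \<open>k = \<rho> n\<close> these intervals eventually contain every positive level, so
one \<open>\<rho>\<close> serves all of them.\<close>

lemma truncated_block_variance_limit:
  fixes a :: "nat \<Rightarrow> real"
  defines "S \<equiv> \<lambda>n::nat. \<lambda>\<omega>. \<Sum>t=1..n. X (int t) \<omega>"
  assumes int: "integrable M (X 0)"
    and norming: "\<forall>\<^sub>F n in sequentially. 0 < a n \<and> real n * trunc (a n) = (a n)\<^sup>2"
  shows "\<exists>\<rho> :: nat \<Rightarrow> nat. filterlim \<rho> at_top sequentially \<and> (\<forall>n. 1 \<le> \<rho> n) \<and>
      (\<forall>r :: nat \<Rightarrow> nat. filterlim r at_top sequentially \<and> (\<forall>n. 1 \<le> r n \<and> r n \<le> \<rho> n) \<longrightarrow>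
        (\<forall>\<epsilon>>0. (\<lambda>n. real_of_int \<lfloor>real n / real (r n)\<rfloor> *
             M.variance (\<lambda>\<omega>. S (r n) \<omega> / a n * of_bool (\<bar>S (r n) \<omega> / a n\<bar> \<le> \<epsilon>)))
          \<longlonglongrightarrow> cluster_mean))"
proof -
  define q where "q n r \<epsilon> = real_of_int \<lfloor>real n / real r\<rfloor> *
      M.variance (\<lambda>\<omega>. S r \<omega> / a n * of_bool (\<bar>S r \<omega> / a n\<bar> \<le> \<epsilon>))" for n r :: nat and \<epsilon>
  define P where "P k n \<longleftrightarrow> (\<forall>r\<in>{1..k}. \<forall>\<epsilon>\<in>{1 / real k..real k}.
      \<bar>q n r \<epsilon> - block_limit r / real r\<bar> \<le> 1 / real k)" for k n
  have ev: "\<forall>\<^sub>F n in sequentially. P k n" for k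
    unfolding P_def
  proof (rule eventually_ball_finite)
    show "\<forall>r\<in>{1..k}. \<forall>\<^sub>F n in sequentially. \<forall>\<epsilon>\<in>{1 / real k..real k}.
        \<bar>q n r \<epsilon> - block_limit r / real r\<bar> \<le> 1 / real k"
      unfolding q_def S_def by (intro ballI block_variance_limit int norming) auto
  qed simp
  obtain \<rho> where \<rho>: "filterlim \<rho> at_top sequentially" "\<And>n. 1 \<le> \<rho> n"
    "\<forall>\<^sub>F n in sequentially. P (\<rho> n) n"
    by (rule diagonal_thresholds[of P, OF ev]) blast
  have \<rho>_real: "filterlim (\<lambda>n. real (\<rho> n)) at_top sequentially"
    by (rule filterlim_compose[OF filterlim_real_sequentially \<rho>(1)])
  have "(\<lambda>n. q n (r n) \<epsilon>) \<longlonglongrightarrow> cluster_mean"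
    if r: "filterlim r at_top sequentially" "\<And>n. 1 \<le> r n" "\<And>n. r n \<le> \<rho> n" and "0 < \<epsilon>" for r \<epsilon>
  proof -
    have "(\<lambda>n. q n (r n) \<epsilon> - block_limit (r n) / real (r n)) \<longlonglongrightarrow> 0"
    proof (rule Lim_null_comparison)
      show "(\<lambda>n. 1 / real (\<rho> n)) \<longlonglongrightarrow> 0"
        by (intro tendsto_divide_0[OF tendsto_const] filterlim_at_top_imp_at_infinity \<rho>_real)
      have "\<forall>\<^sub>F n in sequentially. max \<epsilon> (1 / \<epsilon>) \<le> real (\<rho> n)"
        using \<rho>_real unfolding filterlim_at_top by blast
      with \<rho>(3) show "\<forall>\<^sub>F n in sequentially. norm (q n (r n) \<epsilon> - block_limit (r n) / real (r n)) \<le> 1 / real (\<rho> n)"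
      proof eventually_elim
        case (elim n)
        have "0 < real (\<rho> n)" using \<rho>(2)[of n] by simp
        then have "\<epsilon> \<in> {1 / real (\<rho> n)..real (\<rho> n)}" using elim(2) \<open>0 < \<epsilon>\<close> by (simp add: field_simps)
        moreover have "r n \<in> {1..\<rho> n}" using r by simp
        ultimately show ?case using elim(1) unfolding P_def by simp
      qed
    qed
    from tendsto_add[OF this filterlim_compose[OF block_limit_average r(1)]] show ?thesis by simp
  qed
  then show ?thesis using \<rho> unfolding q_def by blast
qed

end

theorem lemma3p1:
  fixes M :: "'a measure" and N :: "'b measure"
    and X :: "int \<Rightarrow> 'a \<Rightarrow> real" and \<Theta> :: "int \<Rightarrow> 'b \<Rightarrow> real"
    and m :: nat and a :: "nat \<Rightarrow> real"
  defines "S \<equiv> \<lambda>n::nat. \<lambda>\<omega>. \<Sum>t=1..n. X (int t) \<omega>"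
  defines "\<Sigma> \<equiv> \<lambda>\<omega>. (\<Sum>t=0..m. \<Theta> (int t) \<omega>)\<^sup>2 * of_bool (\<forall>i\<in>{1..m}. \<Theta> (- int i) \<omega> = 0)"
  assumes "prob_space M" and "prob_space N"
    and "\<And>t. X t \<in> borel_measurable M" and "\<And>t. \<Theta> t \<in> borel_measurable N"
    and "strictly_stationary M X"
    and "m_dependent m M X"
    and "regularly_varying 2 M X N \<Theta>"
    and "integrable M (X 0)" and "prob_space.expectation M (X 0) = 0"
    and "(\<integral>\<^sup>+ \<omega>. ennreal ((X 0 \<omega> - prob_space.expectation M (X 0))\<^sup>2) \<partial>M) = \<infinity>"
    and "\<forall>\<^sub>F n in sequentially. a n > 0 \<and>
           real n * measure M {\<omega> \<in> space M. \<bar>X 0 \<omega>\<bar> > a n} +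
           real n / (a n)\<^sup>2 *
             prob_space.expectation M (\<lambda>\<omega>. (X 0 \<omega>)\<^sup>2 * of_bool (\<bar>X 0 \<omega>\<bar> \<le> a n)) = 1"
  shows "integrable N \<Sigma> \<and>
    (\<exists>\<rho> :: nat \<Rightarrow> nat. filterlim \<rho> at_top sequentially \<and> (\<forall>n. 1 \<le> \<rho> n) \<and>
      (\<forall>r :: nat \<Rightarrow> nat. filterlim r at_top sequentially \<and> (\<forall>n. 1 \<le> r n \<and> r n \<le> \<rho> n) \<longrightarrow>
        (\<forall>\<epsilon>>0.
          (\<lambda>n. real_of_int \<lfloor>real n / real (r n)\<rfloor> *
             prob_space.variance M
               (\<lambda>\<omega>. S (r n) \<omega> / a n * of_bool (\<bar>S (r n) \<omega> / a n\<bar> \<le> \<epsilon>)))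
          \<longlonglongrightarrow> prob_space.expectation N \<Sigma>)))"
proof -
  from \<open>regularly_varying 2 M X N \<Theta>\<close> have tails: "regularly_varying_tails 2 M (X 0)"
    and "spectral_tail_process 2 M X N \<Theta>"
    by (auto simp: regularly_varying_def)
  then obtain Y where Y: "Y \<in> borel_measurable N"
      "\<And>x. 1 < x \<Longrightarrow> measure N {\<omega> \<in> space N. x < Y \<omega>} = x powr (-2)"
      "prob_space.indep_set N
        (sets (vimage_algebra (space N) Y borel))
        (sets (vimage_algebra (space N) (\<lambda>\<omega> t. \<Theta> t \<omega>) (Pi\<^sub>M UNIV (\<lambda>_. borel))))"
      "\<And>h. 0 \<le> h \<Longrightarrow> weak_conv_on
        (product_topology (\<lambda>_. euclideanreal) {-h..h})
        (\<lambda>x::real. distr (uniform_measure M {\<omega> \<in> space M. \<bar>X 0 \<omega>\<bar> > x})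
               (Pi\<^sub>M {-h..h} (\<lambda>_. borel)) (\<lambda>\<omega>. \<lambda>t\<in>{-h..h}. X t \<omega> / x))
        (distr N (Pi\<^sub>M {-h..h} (\<lambda>_. borel)) (\<lambda>\<omega>. \<lambda>t\<in>{-h..h}. Y \<omega> * \<Theta> t \<omega>))
        at_top"
    unfolding spectral_tail_process_def by blast
  interpret M: prob_space M by fact
  interpret N: prob_space N by fact
  have inf: "(\<integral>\<^sup>+ \<omega>. ennreal ((X 0 \<omega>)\<^sup>2) \<partial>M) = \<infinity>"
    using assms(11,12) by simp
  interpret heavy: m_dependent_heavy_tailed_sequence M N X \<Theta> Y m
    using assms(5-8) tails inf Y
    by unfold_locales
  have "\<forall>\<^sub>F n in sequentially. 0 < a n \<and> real n * heavy.trunc (a n) = (a n)\<^sup>2"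
    using assms(13)
  proof eventually_elim
    case (elim n)
    then have "real n * heavy.trunc (a n) = (a n)\<^sup>2 * 1"
      unfolding heavy.trunc_eq[symmetric, OF conjunct1[OF elim]] conjunct2[OF elim, symmetric]
      by (simp add: field_simps)
    with elim show ?case by simp
  qed
  from heavy.truncated_block_variance_limit[OF \<open>integrable M (X 0)\<close> this]
  show ?thesis
    using heavy.cluster_variance unfolding S_def \<Sigma>_def by simp
qed

end
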